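(* Let $5 \le d \le q$ and let $N_3$ denote the maximum of $|\mathcal{C}(\mathbb{F}_q)|$ over all projective plane curves $\mathcal{C}$ of degree $d$ defined over $\mathbb{F}_q$ satisfying $|\mathcal{C}(\mathbb{F}_q)| < dq - d + 3$. Then $N_3 = dq + 1 - 2(d-3)$ if $d \le \frac{q+5}{2}$, and $N_3 \le (d-1)q + 2$ if $d \ge \frac{q+6}{2}$.
   Context: $\mathbb{F}_q$ is the finite field with $q$ elements. A projective plane curve of degree $d$ defined over $\mathbb{F}_q$ is the zero set in $\mathbb{P}^2$ of a nonzero homogeneous polynomial of degree $d$ in three variables over $\mathbb{F}_q$; $\mathcal{C}(\mathbb{F}_q)$ denotes its set of $\mathbb{F}_q$-rational points. (For $3\le d\le q$ the largest possible value of $|\mathcal{C}(\mathbb{F}_q)|$ is $dq+1$ and the second largest is $dq-d+3$, so $N_3$ is the third largest value.) *)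

theory Defs
  imports Main
begin

definition hom_poly3 :: "nat \<Rightarrow> (nat \<times> nat \<times> nat \<Rightarrow> 'a::field) \<Rightarrow> bool" where
  "hom_poly3 d c \<longleftrightarrow>
     (\<forall>i j k. i + j + k \<noteq> d \<longrightarrow> c (i, j, k) = 0) \<and> (\<exists>i j k. c (i, j, k) \<noteq> 0)"

definition monos3 :: "nat \<Rightarrow> (nat \<times> nat \<times> nat) set" where
  "monos3 d = {(i, j, k). i + j + k = d}"

definition eval_poly3 :: "nat \<Rightarrow> (nat \<times> nat \<times> nat \<Rightarrow> 'a::field) \<Rightarrow> 'a \<times> 'a \<times> 'a \<Rightarrow> 'a" where
  "eval_poly3 d c v = (case v of (x, y, z) \<Rightarrow>
     (\<Sum>(i, j, k)\<in>monos3 d. c (i, j, k) * x ^ i * y ^ j * z ^ k))"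

definition proj_class :: "'a::field \<times> 'a \<times> 'a \<Rightarrow> ('a \<times> 'a \<times> 'a) set" where
  "proj_class v = (case v of (x, y, z) \<Rightarrow> {(l * x, l * y, l * z) | l. l \<noteq> 0})"

definition proj_plane :: "('a::field \<times> 'a \<times> 'a) set set" where
  "proj_plane = {proj_class v | v. v \<noteq> (0, 0, 0)}"

definition curve_points :: "nat \<Rightarrow> (nat \<times> nat \<times> nat \<Rightarrow> 'a::field) \<Rightarrow> ('a \<times> 'a \<times> 'a) set set" where
  "curve_points d c = {P \<in> proj_plane. \<forall>v\<in>P. eval_poly3 d c v = 0}"

definition N3 :: "'a::{finite,field} itself \<Rightarrow> nat \<Rightarrow> nat" where
  "N3 _ d = Max {card (curve_points d c) | c :: nat \<times> nat \<times> nat \<Rightarrow> 'a.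
                   hom_poly3 d c \<and> card (curve_points d c) < d * card (UNIV :: 'a set) - d + 3}"

end

theory Submission
  imports Defs "Berlekamp_Zassenhaus.Unique_Factorization_Poly"
begin

text \<open>Write the curve as a union of \<open>k\<close> lines over \<open>F\<^sub>q\<close> and the zero set \<open>S\<close> of a form \<open>g\<close> of degree
  \<open>e = d - k\<close> without linear factors. If \<open>g\<close> is reducible, counting along lines gives
  \<open>|S| \<le> (e - 1) q + 1\<close>. If \<open>g\<close> is irreducible and does not divide
  \<open>D = x\<^sup>q g\<^sub>x + y\<^sup>q g\<^sub>y + z\<^sup>q g\<^sub>z\<close>, then \<open>g\<close> and \<open>D\<close> have a common tangent direction at every rational
  point, so \<open>2 |S| \<le> e (e + q - 1)\<close> by Bezout, which for \<open>e < q\<close> is again at most \<open>2 ((e - 1) q + 1)\<close>.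
  If \<open>g\<close> divides \<open>D\<close>, every smooth rational point is a flex. Since each line carries total
  intersection multiplicity at most \<open>e\<close>, double counting flags weighted by multiplicity gives
  \<open>(q + 3) |S| \<le> e (q\<^sup>2 + q + 1 - m)\<close> for any \<open>m\<close> lines missing \<open>S\<close>. The same count with
  \<open>q + 2\<close> in place of \<open>q + 3\<close> needs no flexes and settles \<open>e = q\<close>.

  For the lines: if \<open>j \<ge> 3\<close> of them pass through one point, sweeping the plane by the lines through
  that point gives at most \<open>d q + 1 - (j - 1) (d - j)\<close> points on the curve, and \<open>j \<ge> d - 1\<close> leads to one of
  the two largest values or to at most \<open>(d - 1) q + 2\<close> points. Otherwise the lines are in general
  position, and their number of points is known exactly.\<close>

section \<open>Ternary forms as bivariate polynomials\<close>

text \<open>Both regimes come from one dichotomy: a curve with fewer than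
  \<open>d * q - d + 3\<close> points has at most \<open>d * q + 1 - 2 * (d - 3)\<close> or at most
  \<open>(d - 1) * q + 2\<close> points. The first number is at least the second exactly when
  \<open>2 * d \<le> q + 5\<close>, and it is attained whenever \<open>5 \<le> d \<le> q\<close>.
  The ground field is never extended. Orders of vanishing along rational lines replace intersection
  multiplicities over an algebraic closure, and Bezout is proved by comparing sizes of finite sets
  of forms; its factor 2 comes from prescribing a value and one directional derivative at each
  rational point. Bivariate polynomials form a factorial ring, so an irreducible form is prime. The
  delicate case is the one where \<open>g\<close> divides \<open>D\<close>: with
  \<open>m = 0\<close> the weighted count is too weak. If one of the lines meets \<open>S\<close>,
  sweeping \<open>S\<close> from a common point yields \<open>(d - 1) * q + 2\<close>; if none does,
  all \<open>k\<close> lines miss \<open>S\<close>, and \<open>m = k\<close> gains just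
  enough.\<close>

text \<open>A ternary form of degree \<open>n\<close> is encoded by its dehomogenization at \<open>z = 1\<close>, an arbitrary polynomial
  in \<open>x\<close> (inner) and \<open>y\<close> (outer) of total degree at most \<open>n\<close>; the degree is passed separately.
  \<open>hev n f X Y Z\<close> is the value of the form at a point with polynomial coordinates.\<close>


abbreviation cf :: "'a::zero poly poly \<Rightarrow> nat \<Rightarrow> nat \<Rightarrow> 'a" where
  "cf f i j \<equiv> coeff (coeff f j) i"

definition tri :: "nat \<Rightarrow> (nat \<times> nat) set" where
  "tri n = {(i, j). i + j \<le> n}"

definition form :: "nat \<Rightarrow> 'a::field poly poly set" where
  "form n = {f. \<forall>i j. n < i + j \<longrightarrow> cf f i j = 0}"

definition hev :: "nat \<Rightarrow> 'a::field poly poly \<Rightarrow> 'a poly \<Rightarrow> 'a poly \<Rightarrow> 'a poly \<Rightarrow> 'a poly" where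
  "hev n f X Y Z = (\<Sum>(i, j)\<in>tri n. smult (cf f i j) (X ^ i * Y ^ j * Z ^ (n - i - j)))"

lemma finite_tri [simp]: "finite (tri n)"
  by (rule finite_subset[of _ "{..n} \<times> {..n}"]) (auto simp: tri_def)

lemma mem_tri: "(i, j) \<in> tri n \<longleftrightarrow> i + j \<le> n"
  by (simp add: tri_def)

lemma formD: "f \<in> form n \<Longrightarrow> n < i + j \<Longrightarrow> cf f i j = 0"
  by (simp add: form_def)

lemma form_mono: "f \<in> form m \<Longrightarrow> m \<le> n \<Longrightarrow> f \<in> form n"
  by (auto simp: form_def)

lemma form_0 [simp]: "0 \<in> form n"
  by (simp add: form_def)

lemma form_add: "f \<in> form n \<Longrightarrow> g \<in> form n \<Longrightarrow> f + g \<in> form n"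
  and form_diff: "f \<in> form n \<Longrightarrow> g \<in> form n \<Longrightarrow> f - g \<in> form n"
  by (auto simp: form_def)

lemma cf_mult: "cf (f * g) a b = (\<Sum>(i, j)\<in>{..a} \<times> {..b}. cf f i j * cf g (a - i) (b - j))"
proof -
  have "cf (f * g) a b = (\<Sum>j\<le>b. \<Sum>i\<le>a. cf f i j * cf g (a - i) (b - j))"
    by (simp add: coeff_mult coeff_sum)
  also have "\<dots> = (\<Sum>i\<le>a. \<Sum>j\<le>b. cf f i j * cf g (a - i) (b - j))"
    by (rule sum.swap)
  finally show ?thesis by (simp add: sum.cartesian_product)
qed

lemma form_mult:
  assumes f: "f \<in> form m" and g: "g \<in> form n"
  shows "f * g \<in> form (m + n)"
proof -
  have "cf (f * g) a b = 0" if "m + n < a + b" for a b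
    unfolding cf_mult
  proof (rule sum.neutral, safe)
    fix i j assume ij: "i \<le> a" "j \<le> b"
    show "cf f i j * cf g (a - i) (b - j) = 0"
    proof (cases "m < i + j")
      case True then show ?thesis using formD[OF f] by simp
    next
      case False
      then have "n < (a - i) + (b - j)" using that ij by linarith
      then show ?thesis using formD[OF g] by simp
    qed
  qed
  then show ?thesis by (simp add: form_def)
qed

lemma hev_mult:
  assumes f: "f \<in> form m" and g: "g \<in> form n"
  shows "hev (m + n) (f * g) X Y Z = hev m f X Y Z * hev n g X Y Z"
proof -
  define M where "M a b = X ^ a * Y ^ b * Z ^ (m + n - a - b)" for a b
  define t where "t = (\<lambda>((i, j), (k, l)). smult (cf f i j * cf g k l) (M (i + k) (j + l)))"
  \<comment> \<open>\<open>T\<close> is larger than the product of the two triangles, but regrouping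
    by total exponents is a bijection on it; the additional terms vanish because \<open>f\<close>
    and \<open>g\<close> have degree at most \<open>m\<close> and \<open>n\<close>.\<close>
  define T where "T = {((i, j), (k, l)). i + j + k + l \<le> m + n}"
  have finT: "finite T"
    by (rule finite_subset[of _ "({..m+n} \<times> {..m+n}) \<times> ({..m+n} \<times> {..m+n})"]) (auto simp: T_def)
  have "hev m f X Y Z * hev n g X Y Z =
     (\<Sum>p\<in>tri m. \<Sum>r\<in>tri n. t (p, r))"
    unfolding hev_def sum_product
  proof (intro sum.cong refl)
    fix p r assume "p \<in> tri m" "r \<in> tri n"
    then obtain i j k l where p: "p = (i, j)" "r = (k, l)" "i + j \<le> m" "k + l \<le> n"
      by (cases p; cases r) (auto simp: tri_def)
    have "Z ^ (m - i - j) * Z ^ (n - k - l) = Z ^ (m + n - (i + k) - (j + l))"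
      using p by (simp add: power_add[symmetric] algebra_simps)
    then show "(case p of (i, j) \<Rightarrow> smult (cf f i j) (X ^ i * Y ^ j * Z ^ (m - i - j))) *
          (case r of (i, j) \<Rightarrow> smult (cf g i j) (X ^ i * Y ^ j * Z ^ (n - i - j))) = t (p, r)"
      by (simp add: p t_def M_def power_add mult_ac)
  qed
  also have "\<dots> = sum t (tri m \<times> tri n)"
    by (simp add: sum.cartesian_product)
  also have "\<dots> = sum t T"
  proof (rule sum.mono_neutral_left[OF finT])
    show "tri m \<times> tri n \<subseteq> T" by (auto simp: tri_def T_def)
    show "\<forall>x\<in>T - tri m \<times> tri n. t x = 0"
    proof
      fix x assume "x \<in> T - tri m \<times> tri n"
      moreover obtain i j k l where x: "x = ((i, j), (k, l))" by (metis prod.exhaust)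
      ultimately have "m < i + j \<or> n < k + l" by (auto simp: tri_def)
      with x show "t x = 0" using formD[OF f, of i j] formD[OF g, of k l] by (auto simp: t_def)
    qed
  qed
  also have "\<dots> = (\<Sum>(ab, ij)\<in>(SIGMA ab:tri (m + n). {..fst ab} \<times> {..snd ab}).
        t (ij, (fst ab - fst ij, snd ab - snd ij)))"
    by (rule sum.reindex_bij_witness[where
          j = "\<lambda>((i, j), (k, l)). ((i + k, j + l), (i, j))" and
          i = "\<lambda>((a, b), (i, j)). ((i, j), (a - i, b - j))"])
       (auto simp: T_def tri_def)
  also have "\<dots> = (\<Sum>ab\<in>tri (m + n). \<Sum>ij\<in>{..fst ab} \<times> {..snd ab}.
        t (ij, (fst ab - fst ij, snd ab - snd ij)))"
    by (subst sum.Sigma) auto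
  also have "\<dots> = hev (m + n) (f * g) X Y Z"
    unfolding hev_def
  proof (rule sum.cong[OF refl])
    fix ab assume "ab \<in> tri (m + n)"
    obtain a b where ab: "ab = (a, b)" by fastforce
    have "(\<Sum>ij\<in>{..a} \<times> {..b}. t (ij, (a - fst ij, b - snd ij))) =
      (\<Sum>(i, j)\<in>{..a} \<times> {..b}. smult (cf f i j * cf g (a - i) (b - j)) (M a b))"
      by (rule sum.cong) (auto simp: t_def)
    also have "\<dots> = smult (cf (f * g) a b) (M a b)"
      unfolding cf_mult smult_sum by (simp add: case_prod_beta)
    finally show "(\<Sum>ij\<in>{..fst ab} \<times> {..snd ab}. t (ij, (fst ab - fst ij, snd ab - snd ij))) =
       (case ab of (i, j) \<Rightarrow> smult (cf (f * g) i j) (X ^ i * Y ^ j * Z ^ (m + n - i - j)))"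
      by (simp add: ab M_def)
  qed
  finally show ?thesis ..
qed

lemma hev_add: "hev n (f + g) X Y Z = hev n f X Y Z + hev n g X Y Z"
  by (simp add: hev_def smult_add_left case_prod_beta sum.distrib)

lemma hev_diff: "hev n (f - g) X Y Z = hev n f X Y Z - hev n g X Y Z"
  by (simp add: hev_def smult_diff_left case_prod_beta sum_subtractf)

lemma hev_0 [simp]: "hev n 0 X Y Z = 0"
  by (simp add: hev_def)

lemma poly_hev:
  "poly (hev n f X Y Z) t = (\<Sum>(i, j)\<in>tri n. cf f i j * (poly X t ^ i * poly Y t ^ j * poly Z t ^ (n - i - j)))"
  by (simp add: hev_def poly_sum case_prod_beta)

text \<open>The arguments \<open>[:0, 1:]\<close>, \<open>1\<close>, \<open>0\<close> parametrize
  the line z = 0 up to one point. Only monomials with i + j = n survive there, since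
  \<open>0 ^ 0 = 1\<close> and all other powers of 0 vanish, so this restriction is the top-degree
  part of \<open>f\<close>.\<close>

lemma coeff_hev_infinity:
  assumes "i \<le> n"
  shows "coeff (hev n f [:0, 1:] 1 0) i = cf f i (n - i)"
proof -
  have "coeff (hev n f [:0, 1:] 1 0) i =
    (\<Sum>p\<in>tri n. if p = (i, n - i) then cf f i (n - i) else 0)"
    unfolding hev_def coeff_sum
  proof (intro sum.cong refl, clarify)
    fix k l assume "(k, l) \<in> tri n"
    then have kl: "k + l \<le> n" by (simp add: tri_def)
    have "[:0, 1::'a:] ^ k = monom 1 k" by (simp add: monom_altdef)
    then show "coeff (smult (cf f k l) ([:0, 1:] ^ k * 1 ^ l * 0 ^ (n - k - l))) i =
      (if (k, l) = (i, n - i) then cf f i (n - i) else 0)"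
      using kl assms by (cases "n - k - l = 0") (auto simp: power_0_left)
  qed
  also have "\<dots> = cf f i (n - i)"
    using assms by (subst sum.delta) (simp_all add: mem_tri)
  finally show ?thesis .
qed

text \<open>\<open>exact n f\<close>: the form of degree \<open>n\<close> is not divisible by \<open>z\<close>.\<close>

definition exact :: "nat \<Rightarrow> 'a::field poly poly \<Rightarrow> bool" where
  "exact n f \<longleftrightarrow> f \<in> form n \<and> hev n f [:0, 1:] 1 0 \<noteq> 0"

lemma exactD [dest]: "exact n f \<Longrightarrow> f \<in> form n"
  by (simp add: exact_def)

lemma exact_nonzero: "exact n f \<Longrightarrow> f \<noteq> 0"
  by (auto simp: exact_def)

lemma hev_infinity_eq_0:
  assumes "f \<in> form m" "m < n"
  shows "hev n f [:0, 1:] 1 0 = 0"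
  unfolding hev_def
proof (rule sum.neutral, clarify)
  fix i j assume "(i, j) \<in> tri n"
  then show "smult (cf f i j) ([:0, 1:] ^ i * 1 ^ j * 0 ^ (n - i - j)) = 0"
    using formD[OF assms(1), of i j] assms(2) by (cases "i + j = n") (auto simp: tri_def power_0_left)
qed

text \<open>Such a form is z times a form of degree \<open>n\<close>, and z dehomogenizes to 1: the
  polynomial stays the same and only its degree label drops.\<close>

lemma form_lower:
  assumes "f \<in> form (Suc n)" "hev (Suc n) f [:0, 1:] 1 0 = 0"
  shows "f \<in> form n"
  unfolding form_def
proof (clarify)
  fix i j assume "n < i + j"
  then consider "Suc n < i + j" | "i \<le> Suc n" "j = Suc n - i" by linarith
  then show "cf f i j = 0"
  proof cases
    case 1 then show ?thesis using formD[OF assms(1)] by blast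
  next
    case 2 then show ?thesis using coeff_hev_infinity[of i "Suc n" f] assms(2) by simp
  qed
qed

lemma form_exists: "\<exists>n. f \<in> form n"
proof -
  define N where "N = degree f + Max ((\<lambda>j. degree (coeff f j)) ` {..degree f})"
  have "cf f i j = 0" if "N < i + j" for i j
  proof (cases "j \<le> degree f")
    case True
    then have "degree (coeff f j) \<le> Max ((\<lambda>j. degree (coeff f j)) ` {..degree f})"
      by (intro Max_ge) auto
    then have "degree (coeff f j) < i" using that True unfolding N_def by linarith
    then show ?thesis by (rule coeff_eq_0)
  next
    case False then show ?thesis by (simp add: coeff_eq_0)
  qed
  then have "f \<in> form N" by (simp add: form_def)
  then show ?thesis ..
qed

lemma exact_exists:
  assumes "f \<noteq> 0"
  shows "\<exists>n. exact n f"
proof -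
  define n where "n = (LEAST n. f \<in> form n)"
  have n: "f \<in> form n" unfolding n_def using form_exists[of f] by (auto intro: LeastI)
  have "hev n f [:0, 1:] 1 0 \<noteq> 0"
  proof
    assume 0: "hev n f [:0, 1:] 1 0 = 0"
    show False
    proof (cases n)
      case 0
      have "cf f i j = 0" for i j
        using formD[OF n, of i j] coeff_hev_infinity[of 0 n f] \<open>hev n f [:0, 1:] 1 0 = 0\<close> 0
        by (cases "i + j = 0") auto
      then have "f = 0" by (intro poly_eqI) (auto intro!: poly_eqI)
      with assms show False ..
    next
      case (Suc k)
      then have "f \<in> form k" using form_lower n 0 by blast
      then have "n \<le> k" unfolding n_def by (rule Least_le)
      with Suc show False by simp
    qed
  qed
  with n show ?thesis by (auto simp: exact_def)
qed

text \<open>The restrictions to z = 0 are nonzero univariate polynomials, and so is their product.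
  The cancellation rules below rest on this.\<close>

lemma exact_mult: "exact m f \<Longrightarrow> exact n g \<Longrightarrow> exact (m + n) (f * g)"
  by (auto simp: exact_def form_mult hev_mult)

lemma exact_le_form: "exact m f \<Longrightarrow> f \<in> form n \<Longrightarrow> m \<le> n"
  using hev_infinity_eq_0[of f n m] by (auto simp: exact_def not_less[symmetric])

lemma exact_unique: "exact m f \<Longrightarrow> exact n f \<Longrightarrow> m = n"
  by (meson exactD exact_le_form order_antisym)

lemma form_cancel:
  assumes "exact e f" "f * g \<in> form n" "g \<noteq> 0"
  shows "e \<le> n" "g \<in> form (n - e)"
proof -
  obtain b where b: "exact b g" using exact_exists assms(3) by blast
  have "e + b \<le> n" using exact_mult[OF assms(1) b] assms(2) by (rule exact_le_form)
  then show "e \<le> n" "g \<in> form (n - e)" using form_mono[of g b "n - e"] b by auto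
qed

lemma exact_cancel:
  assumes "exact e f" "exact n (f * g)"
  shows "e \<le> n" "exact (n - e) g"
proof -
  have "g \<noteq> 0" using assms(2) by (auto simp: exact_def)
  then obtain b where b: "exact b g" using exact_exists by blast
  have "e + b = n" using exact_unique exact_mult[OF assms(1) b] assms(2) by blast
  then show "e \<le> n" "exact (n - e) g" using b by auto
qed

text \<open>Only constants have exact degree 0; hence both factors of a proper factorization have
  positive degree.\<close>

lemma exact_0_unit:
  assumes f: "exact 0 f"
  shows "f dvd 1"
proof -
  have feq: "f = [:[:cf f 0 0:]:]"
  proof (intro poly_eqI)
    fix j i
    show "cf f i j = cf [:[:cf f 0 0:]:] i j"
      using formD[of f 0 i j] f by (cases i; cases j) (auto simp: exact_def)
  qed
  have "cf f 0 0 \<noteq> 0"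
  proof
    assume "cf f 0 0 = 0"
    with feq have "f = 0" by simp
    then show False using exact_nonzero[OF f] by simp
  qed
  then have "[:cf f 0 0:] dvd 1" by (simp add: is_unit_const_poly_iff dvd_field_iff)
  then show "f dvd 1" by (subst feq) (simp add: is_unit_const_poly_iff)
qed

section \<open>Restriction to lines and the Frobenius polar\<close>

lemma poly_eq_0_if_many_roots:
  fixes p :: "'a::{finite,field} poly"
  assumes "\<And>t. poly p t = 0" "degree p < card (UNIV :: 'a set)"
  shows "p = 0"
proof (rule ccontr)
  assume "p \<noteq> 0"
  then have "card {t. poly p t = 0} \<le> degree p" by (rule card_poly_roots_bound)
  with assms show False by simp
qed

lemma finite_field_power_card:
  fixes x :: "'a::{finite,field}"
  shows "x ^ card (UNIV :: 'a set) = x"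
proof (cases "x = 0")
  case False
  have "x * (\<Prod>y\<in>UNIV-{0}. x * y) = x * x ^ (card (UNIV :: 'a set) - 1) * \<Prod>(UNIV-{0})"
    by (simp add: prod.distrib mult_ac)
  also have "x * x ^ (card (UNIV :: 'a set) - 1) = x ^ Suc (card (UNIV :: 'a set) - 1)"
    by (subst power_Suc) auto
  also have "Suc (card (UNIV :: 'a set) - 1) = card (UNIV :: 'a set)"
    using finite_UNIV_card_ge_0[where ?'a = 'a] by simp
  also have "(\<Prod>y\<in>UNIV-{0}. x * y) = (\<Prod>y\<in>UNIV-{0}. y)"
    by (rule prod.reindex_bij_witness[of _ "\<lambda>y. y / x" "\<lambda>y. x * y"]) (use False in auto)
  finally show ?thesis by simp
qed (use finite_UNIV_card_ge_0[where ?'a = 'a] in auto)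

text \<open>No binomial coefficients are involved: both sides have degree at most q and agree at the
  q field elements and in the coefficient of degree q.\<close>

lemma linear_poly_power_card:
  fixes a b :: "'a::{finite,field}"
  defines "q \<equiv> card (UNIV :: 'a set)"
  shows "[:a, b:] ^ q = [:a:] + smult b ([:0, 1:] ^ q)"
proof -
  have q: "0 < q" using finite_UNIV_card_ge_0[where ?'a = 'a] by (simp add: q_def)
  have "[:a, b:] ^ q = [:a:] + smult b (monom 1 q)"
  proof (rule poly_eqI_degree_lead_coeff[where A = UNIV and n = q])
    show "coeff ([:a, b:] ^ q) q = coeff ([:a:] + smult b (monom 1 q)) q"
      using q finite_field_power_card[of b]
      by (simp add: coeff_linear_poly_power coeff_pCons q_def split: nat.split)
    show "degree ([:a, b:] ^ q) \<le> q"
      by (rule order_trans[OF degree_power_le]) simp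
    show "degree ([:a:] + smult b (monom 1 q)) \<le> q"
      by (intro degree_add_le order_trans[OF degree_smult_le]) (auto simp: degree_monom_eq)
  qed (auto simp: poly_monom finite_field_power_card q_def algebra_simps poly_power)
  then show ?thesis by (simp add: monom_altdef)
qed

type_synonym 'a vec3 = "'a \<times> 'a \<times> 'a"

fun ev :: "nat \<Rightarrow> 'a::field poly poly \<Rightarrow> 'a vec3 \<Rightarrow> 'a" where
  "ev n f (x, y, z) = poly (hev n f [:x:] [:y:] [:z:]) 0"

fun comb :: "'a::field \<Rightarrow> 'a vec3 \<Rightarrow> 'a \<Rightarrow> 'a vec3 \<Rightarrow> 'a vec3" where
  "comb s (a, b, c) t (a', b', c') = (s * a + t * a', s * b + t * b', s * c + t * c')"

text \<open>\<open>lnp n f u w\<close> is the restriction of the form to the line \<open>u + t w\<close>, as a polynomial in \<open>t\<close>.\<close>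

fun lnp :: "nat \<Rightarrow> 'a::field poly poly \<Rightarrow> 'a vec3 \<Rightarrow> 'a vec3 \<Rightarrow> 'a poly" where
  "lnp n f (a, b, c) (a', b', c') = hev n f [:a, a':] [:b, b':] [:c, c':]"

lemma ev_def': "ev n f (x, y, z) = (\<Sum>(i, j)\<in>tri n. cf f i j * (x ^ i * y ^ j * z ^ (n - i - j)))"
  by (simp add: poly_hev)

lemma ev_mult:
  "f \<in> form m \<Longrightarrow> g \<in> form n \<Longrightarrow> ev (m + n) (f * g) v = ev m f v * ev n g v"
  by (cases v) (simp add: hev_mult)

lemma ev_scale: "ev n f (s * x, s * y, s * z) = s ^ n * ev n f (x, y, z)"
proof -
  have "s ^ n = s ^ i * s ^ j * s ^ (n - i - j)" if "(i, j) \<in> tri n" for i j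
    using that by (simp add: mem_tri flip: power_add)
  then show ?thesis
    unfolding ev_def' sum_distrib_left
    by (intro sum.cong) (auto simp: power_mult_distrib mult_ac)
qed

lemma lnp_mult:
  "f \<in> form m \<Longrightarrow> g \<in> form n \<Longrightarrow> lnp (m + n) (f * g) u w = lnp m f u w * lnp n g u w"
  by (cases u; cases w) (simp add: hev_mult)

lemma lnp_add: "lnp n (f + g) u w = lnp n f u w + lnp n g u w"
  by (cases u; cases w) (simp add: hev_add)

lemma poly_lnp: "poly (lnp n f u w) t = ev n f (comb 1 u t w)"
  by (cases u; cases w) (simp add: poly_hev)

lemma coeff_0_lnp: "coeff (lnp n f u w) 0 = ev n f u"
  using poly_lnp[of n f u w 0] by (cases u; cases w) (simp add: poly_0_coeff_0)

lemma pcompose_power: "pcompose (p ^ n) r = pcompose p r ^ n"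
  by (induction n) (simp_all add: pcompose_mult pcompose_1)

lemma pcompose_hev:
  "pcompose (hev n f X Y Z) r = hev n f (pcompose X r) (pcompose Y r) (pcompose Z r)"
  by (simp add: hev_def pcompose_sum case_prod_beta pcompose_smult pcompose_mult pcompose_power)

lemma lnp_shift: "lnp n f (comb 1 u t w) w = pcompose (lnp n f u w) [:t, 1:]"
  by (cases u; cases w) (simp add: pcompose_hev pcompose_pCons algebra_simps)

section \<open>Reversal: exchanging the two base points of a line\<close>

definition rev_rel :: "nat \<Rightarrow> 'a::field poly \<Rightarrow> 'a poly \<Rightarrow> bool" where
  "rev_rel n p r \<longleftrightarrow> degree p \<le> n \<and> degree r \<le> n \<and> (\<forall>k\<le>n. coeff r k = coeff p (n - k))"

text \<open>Padding \<open>reflect_poly\<close> by a monomial makes reversal at the formal degree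
  \<open>n\<close>, which may exceed \<open>degree p\<close>, multiplicative.\<close>

lemma rev_rel_iff:
  "rev_rel n p r \<longleftrightarrow> degree p \<le> n \<and> r = monom 1 (n - degree p) * reflect_poly p"
proof (cases "degree p \<le> n")
  case True
  have c: "coeff (monom 1 (n - degree p) * reflect_poly p) k = (if k \<le> n then coeff p (n - k) else 0)" for k
    using True by (auto simp: coeff_monom_mult coeff_reflect_poly intro!: coeff_eq_0)
  show ?thesis
  proof
    assume R: "rev_rel n p r"
    have "coeff r k = (if k \<le> n then coeff p (n - k) else 0)" for k
      using R by (auto simp: rev_rel_def not_le intro!: coeff_eq_0)
    then have "r = monom 1 (n - degree p) * reflect_poly p" by (intro poly_eqI) (simp only: c)
    then show "degree p \<le> n \<and> r = monom 1 (n - degree p) * reflect_poly p" using True by simp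
  next
    assume "degree p \<le> n \<and> r = monom 1 (n - degree p) * reflect_poly p"
    then have r: "coeff r k = (if k \<le> n then coeff p (n - k) else 0)" for k using c by simp
    have "degree r \<le> n" by (rule degree_le) (simp add: r)
    then show "rev_rel n p r" using True r by (simp add: rev_rel_def)
  qed
qed (auto simp: rev_rel_def)

lemma rev_rel_mult:
  assumes "rev_rel m p r" "rev_rel n p' r'"
  shows "rev_rel (m + n) (p * p') (r * r')"
proof (cases "p = 0 \<or> p' = 0")
  case True
  then show ?thesis using assms by (auto simp: rev_rel_iff)
next
  case False
  then have d: "degree (p * p') = degree p + degree p'" by (simp add: degree_mult_eq)
  have le: "degree p \<le> m" "degree p' \<le> n" using assms by (auto simp: rev_rel_iff)
  then have e: "m + n - degree (p * p') = (m - degree p) + (n - degree p')" using d by simp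
  have "monom 1 (m + n - degree (p * p')) = monom (1::'a) (m - degree p) * monom 1 (n - degree p')"
    unfolding e by (simp add: mult_monom)
  then show ?thesis using assms le d by (simp add: rev_rel_iff reflect_poly_mult mult_ac)
qed

lemma rev_rel_power: "rev_rel 1 p r \<Longrightarrow> rev_rel n (p ^ n) (r ^ n)"
proof (induction n)
  case 0 then show ?case by (simp add: rev_rel_def)
next
  case (Suc n)
  then show ?case using rev_rel_mult[of 1 p r n "p ^ n" "r ^ n"] by simp
qed

lemma rev_rel_sum:
  "(\<And>x. x \<in> A \<Longrightarrow> rev_rel n (p x) (r x)) \<Longrightarrow> rev_rel n (\<Sum>x\<in>A. p x) (\<Sum>x\<in>A. r x)"
  by (induction A rule: infinite_finite_induct) (auto simp: rev_rel_def degree_add_le)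

lemma rev_rel_linear: "rev_rel 1 [:a, b:] [:b, a:]"
  by (auto simp: rev_rel_def le_Suc_eq)

text \<open>The restriction to s u + t w is a binary form of degree \<open>n\<close>, and swapping
  \<open>u\<close> and \<open>w\<close> swaps s and t. Vanishing at \<open>w\<close>, which no
  finite parameter reaches, thus becomes visible as a degree drop.\<close>

lemma rev_rel_lnp: "rev_rel n (lnp n f u w) (lnp n f w u)"
proof -
  obtain a b c a' b' c' where uw: "u = (a, b, c)" "w = (a', b', c')" by (metis prod.exhaust)
  have "rev_rel n (smult (cf f i j) ([:a, a':] ^ i * [:b, b':] ^ j * [:c, c':] ^ (n - i - j)))
     (smult (cf f i j) ([:a', a:] ^ i * [:b', b:] ^ j * [:c', c:] ^ (n - i - j)))"
    if "(i, j) \<in> tri n" for i j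
  proof -
    have n: "i + j + (n - i - j) = n" using that by (simp add: mem_tri)
    have "rev_rel (i + j + (n - i - j)) ([:a, a':] ^ i * [:b, b':] ^ j * [:c, c':] ^ (n - i - j))
       ([:a', a:] ^ i * [:b', b:] ^ j * [:c', c:] ^ (n - i - j))"
      by (intro rev_rel_mult rev_rel_power rev_rel_linear)
    then show ?thesis unfolding n by (auto simp: rev_rel_def intro: order_trans[OF degree_smult_le])
  qed
  then show ?thesis unfolding uw lnp.simps hev_def by (intro rev_rel_sum) auto
qed

lemma degree_lnp: "degree (lnp n f u w) \<le> n"
  using rev_rel_lnp[of n f u w] by (simp add: rev_rel_def)

lemma coeff_lnp_swap: "k \<le> n \<Longrightarrow> coeff (lnp n f w u) k = coeff (lnp n f u w) (n - k)"
  using rev_rel_lnp[of n f u w] by (auto simp: rev_rel_def)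

section \<open>Partial derivatives and the Frobenius polar\<close>

definition px :: "'a::field poly poly" where "px = [:[:0, 1:]:]"
definition py :: "'a::field poly poly" where "py = [:0, 1:]"

text \<open>The last partial derivative is obtained from the other two by Euler's formula.\<close>

definition dx :: "'a::field poly poly \<Rightarrow> 'a poly poly" where "dx f = map_poly pderiv f"
definition dy :: "'a::field poly poly \<Rightarrow> 'a poly poly" where "dy f = pderiv f"
definition dz :: "nat \<Rightarrow> 'a::field poly poly \<Rightarrow> 'a poly poly" where
  "dz n f = of_nat n * f - px * dx f - py * dy f"

lemma cf_dx: "cf (dx f) i j = of_nat (Suc i) * cf f (Suc i) j"
  by (simp add: dx_def coeff_map_poly coeff_pderiv)

lemma cf_dy: "cf (dy f) i j = of_nat (Suc j) * cf f i (Suc j)"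
  by (simp add: dy_def coeff_pderiv of_nat_poly del: of_nat_Suc)

text \<open>This justifies the name \<open>dz\<close>: \<open>n - i - j\<close> is the exponent of z
  belonging to \<open>(i, j)\<close>.\<close>

lemma cf_dz:
  assumes "i + j \<le> n"
  shows "cf (dz n f) i j = of_nat (n - i - j) * cf f i j"
proof -
  have "cf (px * dx f) i j = of_nat i * cf f i j"
    by (cases i) (simp_all add: cf_dx px_def)
  moreover have "cf (py * dy f) i j = of_nat j * cf f i j"
    by (cases j) (simp_all add: cf_dy py_def)
  ultimately show ?thesis using assms
    by (simp add: dz_def of_nat_poly of_nat_diff algebra_simps)
qed

lemma form_dx: "f \<in> form (Suc n) \<Longrightarrow> dx f \<in> form n"
  and form_dy: "f \<in> form (Suc n) \<Longrightarrow> dy f \<in> form n"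
  by (auto simp: form_def cf_dx cf_dy simp del: of_nat_Suc)

lemma form_px: "px \<in> form 1" and form_py: "py \<in> form 1" and form_1: "1 \<in> form n"
  by (auto simp: form_def px_def py_def coeff_pCons split: nat.split)

lemma form_of_nat: "of_nat k \<in> form n"
  by (auto simp: form_def of_nat_poly coeff_pCons split: nat.split)

lemma form_power: "f \<in> form m \<Longrightarrow> f ^ k \<in> form (k * m)"
proof (induction k)
  case (Suc k)
  then show ?case using form_mult[of f m "f ^ k" "k * m"] by simp
qed (simp add: form_1)

lemma hev_power: "f \<in> form m \<Longrightarrow> hev (k * m) (f ^ k) X Y Z = hev m f X Y Z ^ k"
proof (induction k)
  case 0 show ?case by (simp add: hev_def tri_def)
next
  case (Suc k)
  then show ?case using hev_mult[OF Suc.prems form_power[OF Suc.prems], of k X Y Z] by simp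
qed

lemma tri_1: "tri (Suc 0) = {(0, 0), (0, 1), (1, 0)}"
  by (auto simp: tri_def)

lemma hev_px [simp]: "hev (Suc 0) px X Y Z = X"
  and hev_py [simp]: "hev (Suc 0) py X Y Z = Y"
  and hev_1 [simp]: "hev (Suc 0) 1 X Y Z = Z"
  by (simp_all add: hev_def tri_1 px_def py_def)

lemma form_dz:
  assumes "f \<in> form (Suc n)"
  shows "dz (Suc n) f \<in> form n"
proof -
  have "dz (Suc n) f \<in> form (Suc n)"
    unfolding dz_def
    using form_mult[OF form_of_nat[of "Suc n" 0] assms] form_mult[OF form_px form_dx[OF assms]]
      form_mult[OF form_py form_dy[OF assms]]
    by (intro form_diff) simp_all
  then have "cf (dz (Suc n) f) i j = 0" if "n < i + j" for i j
    using cf_dz[of i j "Suc n" f] formD[of "dz (Suc n) f" "Suc n" i j] that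
    by (cases "i + j = Suc n") (simp_all del: of_nat_Suc)
  then show ?thesis by (simp add: form_def)
qed

lemma euler_hev:
  assumes "f \<in> form (Suc n)"
  shows "X * hev n (dx f) X Y Z + Y * hev n (dy f) X Y Z + Z * hev n (dz (Suc n) f) X Y Z
     = of_nat (Suc n) * hev (Suc n) f X Y Z"
proof -
  have "hev (Suc n) (dz (Suc n) f) X Y Z = Z * hev n (dz (Suc n) f) X Y Z"
    using hev_mult[OF form_1[of 1] form_dz[OF assms], of X Y Z] by simp
  moreover have "hev (Suc n) (px * dx f) X Y Z = X * hev n (dx f) X Y Z"
    using hev_mult[OF form_px form_dx[OF assms], of X Y Z] by simp
  moreover have "hev (Suc n) (py * dy f) X Y Z = Y * hev n (dy f) X Y Z"
    using hev_mult[OF form_py form_dy[OF assms], of X Y Z] by simp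
  moreover have "hev (Suc n) (of_nat (Suc n) * f) X Y Z = of_nat (Suc n) * hev (Suc n) f X Y Z"
    by (simp add: hev_def of_nat_poly smult_sum2 case_prod_beta del: of_nat_Suc)
  moreover have "hev (Suc n) (dz (Suc n) f) X Y Z = hev (Suc n) (of_nat (Suc n) * f) X Y Z
      - hev (Suc n) (px * dx f) X Y Z - hev (Suc n) (py * dy f) X Y Z"
    unfolding dz_def hev_diff ..
  ultimately show ?thesis by (simp add: algebra_simps del: of_nat_Suc)
qed

text \<open>Chain rule along a polynomial arc. The product rule splits each monomial into three
  terms; those with exponent 0 have coefficient 0, so the truncated \<open>i - 1\<close> does no
  harm and reindexing gives the partial derivatives.\<close>

lemma pderiv_hev:
  "pderiv (hev (Suc n) f X Y Z) = hev n (dx f) X Y Z * pderiv X + hev n (dy f) X Y Z * pderiv Y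
      + hev n (dz (Suc n) f) X Y Z * pderiv Z"
proof -
  let ?T = "tri (Suc n)"
  let ?k = "\<lambda>i j. Suc n - i - j"
  have 1: "(\<Sum>(i, j)\<in>?T. smult (cf f i j * of_nat i) (X ^ (i - 1) * Y ^ j * Z ^ ?k i j)) = hev n (dx f) X Y Z"
  proof -
    have "(\<Sum>(i, j)\<in>?T. smult (cf f i j * of_nat i) (X ^ (i - 1) * Y ^ j * Z ^ ?k i j)) =
      (\<Sum>(i, j)\<in>{(i, j). (i, j) \<in> ?T \<and> 0 < i}. smult (cf f i j * of_nat i) (X ^ (i - 1) * Y ^ j * Z ^ ?k i j))"
      by (rule sum.mono_neutral_right) (auto intro!: gr0I)
    also have "\<dots> = hev n (dx f) X Y Z"
      unfolding hev_def
      by (rule sum.reindex_bij_witness[where i = "\<lambda>(i, j). (Suc i, j)" and j = "\<lambda>(i, j). (i - 1, j)"])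
         (auto simp: mem_tri cf_dx mult.commute simp del: of_nat_Suc)
    finally show ?thesis .
  qed
  have 2: "(\<Sum>(i, j)\<in>?T. smult (cf f i j * of_nat j) (X ^ i * Y ^ (j - 1) * Z ^ ?k i j)) = hev n (dy f) X Y Z"
  proof -
    have "(\<Sum>(i, j)\<in>?T. smult (cf f i j * of_nat j) (X ^ i * Y ^ (j - 1) * Z ^ ?k i j)) =
      (\<Sum>(i, j)\<in>{(i, j). (i, j) \<in> ?T \<and> 0 < j}. smult (cf f i j * of_nat j) (X ^ i * Y ^ (j - 1) * Z ^ ?k i j))"
      by (rule sum.mono_neutral_right) (auto intro!: gr0I)
    also have "\<dots> = hev n (dy f) X Y Z"
      unfolding hev_def
      by (rule sum.reindex_bij_witness[where i = "\<lambda>(i, j). (i, Suc j)" and j = "\<lambda>(i, j). (i, j - 1)"])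
         (auto simp: mem_tri cf_dy mult.commute simp del: of_nat_Suc)
    finally show ?thesis .
  qed
  have 3: "(\<Sum>(i, j)\<in>?T. smult (cf f i j * of_nat (?k i j)) (X ^ i * Y ^ j * Z ^ (?k i j - 1))) = hev n (dz (Suc n) f) X Y Z"
  proof -
    have "hev n (dz (Suc n) f) X Y Z =
       (\<Sum>(i, j)\<in>tri n. smult (cf f i j * of_nat (?k i j)) (X ^ i * Y ^ j * Z ^ (?k i j - 1)))"
      unfolding hev_def
      by (rule sum.cong) (auto simp: mem_tri cf_dz mult.commute Suc_diff_le simp del: of_nat_Suc)
    also have "\<dots> = (\<Sum>(i, j)\<in>?T. smult (cf f i j * of_nat (?k i j)) (X ^ i * Y ^ j * Z ^ (?k i j - 1)))"
    proof (rule sum.mono_neutral_left)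
      show "tri n \<subseteq> ?T" by (auto simp: tri_def)
      show "\<forall>p\<in>?T - tri n. (case p of (i, j) \<Rightarrow> smult (cf f i j * of_nat (?k i j)) (X ^ i * Y ^ j * Z ^ (?k i j - 1))) = 0"
      proof (clarify)
        fix i j assume "(i, j) \<in> ?T" "(i, j) \<notin> tri n"
        then have "?k i j = 0" by (simp add: mem_tri)
        then show "smult (cf f i j * of_nat (?k i j)) (X ^ i * Y ^ j * Z ^ (?k i j - 1)) = 0" by simp
      qed
    qed simp
    finally show ?thesis ..
  qed
  have "pderiv (hev (Suc n) f X Y Z) = (\<Sum>(i, j)\<in>?T.
       smult (cf f i j * of_nat i) (X ^ (i - 1) * Y ^ j * Z ^ ?k i j) * pderiv X +
       smult (cf f i j * of_nat j) (X ^ i * Y ^ (j - 1) * Z ^ ?k i j) * pderiv Y +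
       smult (cf f i j * of_nat (?k i j)) (X ^ i * Y ^ j * Z ^ (?k i j - 1)) * pderiv Z)"
    unfolding hev_def pderiv_sum
    by (rule sum.cong) (auto simp: pderiv_smult pderiv_mult pderiv_power smult_add_right algebra_simps simp del: of_nat_Suc)
  then show ?thesis
    unfolding 1[symmetric] 2[symmetric] 3[symmetric] sum_distrib_right sum.distrib[symmetric]
    by (simp add: case_prod_beta del: of_nat_Suc)
qed

text \<open>The form \<open>D\<close> in the chart z = 1, where the factor z^q of the last summand
  becomes 1. Its degree is \<open>q + n\<close> when \<open>f\<close> has degree
  \<open>Suc n\<close>.\<close>

definition frob :: "nat \<Rightarrow> nat \<Rightarrow> 'a::field poly poly \<Rightarrow> 'a poly poly" where
  "frob q n f = px ^ q * dx f + py ^ q * dy f + dz n f"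

lemma frob_parts:
  assumes "f \<in> form (Suc n)"
  shows "frob q (Suc n) f \<in> form (q + n)"
    and "hev (q + n) (frob q (Suc n) f) X Y Z =
      X ^ q * hev n (dx f) X Y Z + Y ^ q * hev n (dy f) X Y Z + Z ^ q * hev n (dz (Suc n) f) X Y Z"
proof -
  have q: "px ^ q \<in> form q" "py ^ q \<in> form q" "1 \<in> form q"
    using form_power[OF form_px, of q] form_power[OF form_py, of q] by (simp_all add: form_1)
  have h: "hev q (px ^ q) X Y Z = X ^ q" "hev q (py ^ q) X Y Z = Y ^ q" "hev q 1 X Y Z = Z ^ q"
    using hev_power[OF form_px, of q X Y Z] hev_power[OF form_py, of q X Y Z]
      hev_power[OF form_1[of 1], of q X Y Z] by simp_all
  note m = form_mult[OF q(1) form_dx[OF assms]] form_mult[OF q(2) form_dy[OF assms]]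
    form_mult[OF q(3) form_dz[OF assms]]
  then show "frob q (Suc n) f \<in> form (q + n)"
    unfolding frob_def by (intro form_add) simp_all
  show "hev (q + n) (frob q (Suc n) f) X Y Z =
      X ^ q * hev n (dx f) X Y Z + Y ^ q * hev n (dy f) X Y Z + Z ^ q * hev n (dz (Suc n) f) X Y Z"
    using hev_mult[OF q(1) form_dx[OF assms], of X Y Z] hev_mult[OF q(2) form_dy[OF assms], of X Y Z]
      hev_mult[OF q(3) form_dz[OF assms], of X Y Z]
    by (simp add: frob_def hev_add h)
qed

text \<open>On the line, the q-th power of a coordinate a + a' t is a + a' t^q, that is, the
  coordinate itself plus a' (t^q - t). Euler's formula collects the first parts and the chain rule
  the second.\<close>

lemma lnp_frob:
  fixes f :: "'a::{finite,field} poly poly"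
  defines "q \<equiv> card (UNIV :: 'a set)"
  assumes "f \<in> form (Suc n)"
  shows "lnp (q + n) (frob q (Suc n) f) u w =
    of_nat (Suc n) * lnp (Suc n) f u w + ([:0, 1:] ^ q - [:0, 1:]) * pderiv (lnp (Suc n) f u w)"
proof -
  obtain a b c a' b' c' where uw: "u = (a, b, c)" "w = (a', b', c')" by (metis prod.exhaust)
  let ?X = "[:a, a':]" and ?Y = "[:b, b':]" and ?Z = "[:c, c':]"
  let ?fx = "hev n (dx f) ?X ?Y ?Z" and ?fy = "hev n (dy f) ?X ?Y ?Z" and ?fz = "hev n (dz (Suc n) f) ?X ?Y ?Z"
  define T where "T = [:0, 1::'a:]"
  have lin: "[:r, s:] = [:r:] + [:s:] * T" for r s :: 'a by (simp add: T_def)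
  have fr: "[:r, s:] ^ q = [:r:] + [:s:] * T ^ q" for r s :: 'a
    unfolding q_def T_def by (simp add: linear_poly_power_card)
  have alg: "(A + A' * Q) * x + (B + B' * Q) * y + (C + C' * Q) * z =
     ((A + A' * t) * x + (B + B' * t) * y + (C + C' * t) * z) + (Q - t) * (x * A' + y * B' + z * C')"
    for A A' B B' C C' Q t x y z :: "'a poly" by (simp add: algebra_simps)
  have "lnp (q + n) (frob q (Suc n) f) u w = ?X ^ q * ?fx + ?Y ^ q * ?fy + ?Z ^ q * ?fz"
    by (simp only: uw lnp.simps frob_parts(2)[OF assms(2)])
  also have "\<dots> = (?X * ?fx + ?Y * ?fy + ?Z * ?fz) + (T ^ q - T) * (?fx * [:a':] + ?fy * [:b':] + ?fz * [:c':])"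
    unfolding fr unfolding lin[of a a'] lin[of b b'] lin[of c c'] by (rule alg)
  also have "\<dots> = of_nat (Suc n) * lnp (Suc n) f u w + (T ^ q - T) * pderiv (lnp (Suc n) f u w)"
    unfolding euler_hev[OF assms(2)] uw lnp.simps pderiv_hev by (simp add: pderiv_pCons)
  finally show ?thesis by (simp only: T_def)
qed

section \<open>Points and lines\<close>

text \<open>Points and lines of the plane are both represented by normalized coordinate triples.\<close>

fun dot :: "'a::field vec3 \<Rightarrow> 'a vec3 \<Rightarrow> 'a" where
  "dot (a, b, c) (x, y, z) = a * x + b * y + c * z"

fun cross :: "'a::field vec3 \<Rightarrow> 'a vec3 \<Rightarrow> 'a vec3" where
  "cross (a, b, c) (x, y, z) = (b * z - c * y, c * x - a * z, a * y - b * x)"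

fun scale :: "'a::field \<Rightarrow> 'a vec3 \<Rightarrow> 'a vec3" where
  "scale s (x, y, z) = (s * x, s * y, s * z)"

definition pts :: "'a::field vec3 set" where
  "pts = {(x, y, 1) | x y. True} \<union> {(x, 1, 0) | x. True} \<union> {(1, 0, 0)}"

definition line :: "'a::field vec3 \<Rightarrow> 'a vec3 set" where
  "line c = {P \<in> pts. dot c P = 0}"

lemma dot_commute: "dot u v = dot v u"
  by (cases u; cases v) (simp add: mult.commute)

lemma pts_cases:
  assumes "P \<in> pts"
  obtains (affine) x y where "P = (x, y, 1)" | (infinite) x where "P = (x, 1, 0)" | (last) "P = (1, 0, 0)"
  using assms by (auto simp: pts_def)

lemma pts_nonzero: "P \<in> pts \<Longrightarrow> P \<noteq> (0, 0, 0)"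
  by (auto simp: pts_def)

lemma pts_I [simp, intro]: "(x, y, 1) \<in> pts" "(x, 1, 0) \<in> pts" "(1, 0, 0) \<in> pts"
  by (auto simp: pts_def)

lemma cross_pts_eq: "P \<in> pts \<Longrightarrow> Q \<in> pts \<Longrightarrow> cross P Q = (0, 0, 0) \<Longrightarrow> P = Q"
  by (elim pts_cases) auto

lemma normalize:
  assumes "v \<noteq> (0, 0, 0)"
  obtains s p where "s \<noteq> 0" "p \<in> pts" "v = scale s p"
proof -
  obtain x y z where v: "v = (x, y, z)" by (metis prod.exhaust)
  show thesis
  proof (cases "z = 0")
    case False
    then show ?thesis using that[of z "(x / z, y / z, 1)"] v by simp
  next
    case z: True
    show ?thesis
    proof (cases "y = 0")
      case False
      then show ?thesis using that[of y "(x / y, 1, 0)"] v z by simp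
    next
      case True
      then show ?thesis using that[of x "(1, 0, 0)"] v z assms by simp
    qed
  qed
qed

lemma scale_pts_unique:
  assumes "P \<in> pts" "Q \<in> pts" "P = scale s Q"
  shows "P = Q" "s = 1"
  using assms by (auto elim!: pts_cases)

text \<open>Triple product: c x (P x Q) = (c . Q) P - (c . P) Q.\<close>

lemma cross_cross_zero: "dot c P = 0 \<Longrightarrow> dot c Q = 0 \<Longrightarrow> cross c (cross P Q) = (0, 0, 0)"
proof -
  assume *: "dot c P = 0" "dot c Q = 0"
  obtain c1 c2 c3 where c: "c = (c1, c2, c3)" by (metis prod.exhaust)
  obtain p1 p2 p3 where P: "P = (p1, p2, p3)" by (metis prod.exhaust)
  obtain q1 q2 q3 where Q: "Q = (q1, q2, q3)" by (metis prod.exhaust)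
  have "cross c (cross P Q) = (p1 * dot c Q - q1 * dot c P, p2 * dot c Q - q2 * dot c P, p3 * dot c Q - q3 * dot c P)"
    by (simp add: c P Q algebra_simps)
  with * show ?thesis by simp
qed

lemma dot_cross: "dot (cross P Q) P = 0" "dot (cross P Q) Q = 0"
  by (cases P; cases Q; simp add: algebra_simps)+

lemma dot_scale: "dot (scale s u) v = s * dot u v" "dot u (scale s v) = s * dot u v"
  by (cases u; cases v; simp add: algebra_simps)+

lemma cross_scale: "cross u (scale s v) = scale s (cross u v)"
  by (cases u; cases v) (simp add: algebra_simps)

lemma scale_eq_0: "s \<noteq> 0 \<Longrightarrow> scale s v = (0, 0, 0) \<longleftrightarrow> v = (0, 0, 0)"
  by (cases v) simp

text \<open>The normalized cross product is the join, and the triple product makes it unique. As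
  lines are triples too, the same statement provides the meeting point of two lines.\<close>

lemma join_ex1:
  assumes "P \<in> pts" "Q \<in> pts" "P \<noteq> Q"
  shows "\<exists>!c. c \<in> pts \<and> dot c P = 0 \<and> dot c Q = 0"
proof -
  have "cross P Q \<noteq> (0, 0, 0)" using cross_pts_eq assms by blast
  then obtain s p where p: "s \<noteq> 0" "p \<in> pts" "cross P Q = scale s p" by (rule normalize)
  show ?thesis
  proof (rule ex1I[of _ p])
    show "p \<in> pts \<and> dot p P = 0 \<and> dot p Q = 0"
      using p dot_cross[of P Q] by (simp add: dot_scale)
    fix c assume c: "c \<in> pts \<and> dot c P = 0 \<and> dot c Q = 0"
    then have "cross c (scale s p) = (0, 0, 0)" using cross_cross_zero p(3) by metis
    then have "cross c p = (0, 0, 0)" using p(1) by (simp add: cross_scale scale_eq_0)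
    then show "c = p" using cross_pts_eq c p(2) by blast
  qed
qed

text \<open>\<open>w\<close> is the point at parameter infinity. The base points are chosen so that
  every \<open>comb 1 u t w\<close> is already normalized; no rescaling interferes with counting or
  with orders of vanishing.\<close>

lemma line_param:
  assumes "c \<in> pts"
  obtains u w where "u \<in> pts" "w \<in> pts" "inj (\<lambda>t. comb 1 u t w)" "w \<notin> range (\<lambda>t. comb 1 u t w)"
    "line c = insert w (range (\<lambda>t. comb 1 u t w))"
proof -
  note result = that
  obtain a b e where c: "c = (a, b, e)" by (metis prod.exhaust)
  \<comment> \<open>All lines except z = 0: \<open>(x, y, 0)\<close> is the point at infinity of the
    line and \<open>(x', y', 1)\<close> an affine point on it.\<close>
  have aff: thesis if ab: "a * x + b * y = 0" "a * x' + b * y' + e = 0" "(x, y, 0) \<in> pts" "a \<noteq> 0 \<or> b \<noteq> 0" for x y x' y'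
  proof -
    have xy: "x \<noteq> 0 \<or> y \<noteq> 0" using ab(3) by (auto simp: pts_def)
    let ?f = "\<lambda>t. comb 1 (x', y', 1) t (x, y, 0)"
    have par: "\<exists>t. u = t * x \<and> v = t * y" if "a * u + b * v = 0" for u v
    proof -
      have d: "u * y = v * x"
      proof (cases "a = 0")
        case True
        then show ?thesis using ab that by auto
      next
        case False
        then have "u = - b * v / a" "x = - b * y / a" using ab that by (auto simp: field_simps eq_neg_iff_add_eq_0)
        then show ?thesis by simp
      qed
      show ?thesis
      proof (cases "x = 0")
        case True
        then show ?thesis using d xy by (intro exI[of _ "v / y"]) auto
      next
        case False
        then show ?thesis using d by (intro exI[of _ "u / x"]) (simp add: field_simps)
      qed
    qed
    have "line c = insert (x, y, 0) (range ?f)"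
    proof (intro equalityI subsetI)
      fix P assume "P \<in> line c"
      then have P: "P \<in> pts" "dot c P = 0" by (auto simp: line_def)
      from P(1) show "P \<in> insert (x, y, 0) (range ?f)"
      proof (cases rule: pts_cases)
        case (affine u v)
        have "a * (u - x') + b * (v - y') = (a * u + b * v + e) - (a * x' + b * y' + e)"
          by (simp add: algebra_simps)
        also have "\<dots> = 0" using P(2) ab(2) by (simp add: c affine)
        finally obtain t where "u - x' = t * x" "v - y' = t * y" using par by blast
        then have "P = ?f t" by (simp add: affine algebra_simps)
        then show ?thesis by blast
      next
        case (infinite u)
        then have "a * u + b * 1 = 0" using P(2) by (simp add: c)
        then obtain t where t: "u = t * x" "1 = t * y" using par by blast
        then have "P = scale t (x, y, 0)" by (simp add: infinite)
        then show ?thesis using scale_pts_unique(1)[OF P(1) ab(3)] by blast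
      next
        case last
        then have "a * 1 + b * 0 = 0" using P(2) by (simp add: c)
        then obtain t where t: "1 = t * x" "0 = t * y" using par by blast
        then have "P = scale t (x, y, 0)" by (simp add: last)
        then show ?thesis using scale_pts_unique(1)[OF P(1) ab(3)] by blast
      qed
    next
      fix P assume "P \<in> insert (x, y, 0) (range ?f)"
      then show "P \<in> line c"
      proof
        assume "P = (x, y, 0)" then show ?thesis using ab by (simp add: line_def c)
      next
        assume "P \<in> range ?f"
        then obtain t where t: "P = ?f t" by blast
        have "dot c P = (a * x' + b * y' + e) + t * (a * x + b * y)"
          by (simp add: t c algebra_simps)
        then show ?thesis using ab t by (simp add: line_def)
      qed
    qed
    moreover have "inj ?f" using xy by (intro injI) auto
    moreover have "(x, y, 0) \<notin> range ?f" by auto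
    ultimately show thesis by (intro result[of "(x', y', 1)" "(x, y, 0)"]) (use ab(3) in auto)
  qed
  show thesis
  proof (cases "a = 0")
    case False
    show ?thesis by (rule aff[of "- b / a" 1 "- e / a" 0]) (use False in auto)
  next
    case a: True
    show ?thesis
    proof (cases "b = 0")
      case False
      show ?thesis by (rule aff[of 1 0 0 "- e / b"]) (use a False in auto)
    next
      case True
      then have "e = 1" using assms a c by (auto simp: pts_def)
      then have "line c = insert (1, 0, 0) (range (\<lambda>t. comb 1 (0, 1, 0) t (1, 0, 0)))"
        using a True by (auto simp: line_def c elim!: pts_cases)
      then show ?thesis by (intro result[of "(0, 1, 0)" "(1, 0, 0)"]) (auto intro!: injI)
    qed
  qed
qed

lemma card_line:
  fixes c :: "'a::{finite,field} vec3"
  assumes "c \<in> pts"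
  shows "card (line c) = card (UNIV :: 'a set) + 1"
proof -
  obtain u w where uw: "inj (\<lambda>t. comb 1 u t w)" "w \<notin> range (\<lambda>t. comb 1 u t w)"
    "line c = insert w (range (\<lambda>t. comb 1 u t w))" using line_param[OF assms] by metis
  show ?thesis unfolding uw(3) using uw(2) by (simp add: card_image[OF uw(1)])
qed

lemma card_pts:
  "card (pts :: 'a::{finite,field} vec3 set) = card (UNIV :: 'a set) ^ 2 + card (UNIV :: 'a set) + 1"
proof -
  let ?A = "(\<lambda>(x, y). (x, y, 1::'a)) ` (UNIV :: ('a \<times> 'a) set)"
  let ?B = "(\<lambda>x. (x, 1::'a, 0::'a)) ` (UNIV :: 'a set)"
  have "pts = (?A \<union> ?B) \<union> {(1, 0, 0)}" by (auto simp: pts_def)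
  moreover have "card ?A = card (UNIV :: 'a set) ^ 2"
    by (subst card_image) (auto simp: inj_on_def power2_eq_square card_cartesian_product simp flip: UNIV_Times_UNIV)
  moreover have "card ?B = card (UNIV :: 'a set)" by (subst card_image) (auto simp: inj_on_def)
  moreover have "card (?A \<union> ?B) = card ?A + card ?B" by (rule card_Un_disjoint) auto
  moreover have "card ((?A \<union> ?B) \<union> {(1, 0, 0)}) = card (?A \<union> ?B) + 1" by (subst card_Un_disjoint) auto
  ultimately show ?thesis by simp
qed

section \<open>Zero sets of forms\<close>

definition zs :: "nat \<Rightarrow> 'a::field poly poly \<Rightarrow> 'a vec3 set" where
  "zs n f = {P \<in> pts. ev n f P = 0}"

lemma finite_vec3 [simp]: "finite (A :: 'a::{finite,field} vec3 set)"
  by (rule finite_subset[OF subset_UNIV]) simp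

lemma zs_sub: "zs n f \<subseteq> pts"
  by (auto simp: zs_def)

lemma zs_mult: "f \<in> form m \<Longrightarrow> g \<in> form n \<Longrightarrow> zs (m + n) (f * g) = zs m f \<union> zs n g"
  by (auto simp: zs_def ev_mult)

text \<open>The condition speaks of rational points only. It excludes linear factors over the field,
  and for degrees up to q it is equivalent to their absence by \<open>lform_dvd\<close>.\<close>

definition lineless :: "nat \<Rightarrow> 'a::field poly poly \<Rightarrow> bool" where
  "lineless n f \<longleftrightarrow> (\<forall>c\<in>pts. \<not> line c \<subseteq> zs n f)"

section \<open>Counting flags with multiplicities\<close>

lemma X_power_dvd_iff: "[:0, 1::'a::field:] ^ k dvd p \<longleftrightarrow> (\<forall>i<k. coeff p i = 0)"
proof
  assume "[:0, 1:] ^ k dvd p"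
  then obtain h where "p = monom 1 k * h" by (auto simp: monom_altdef)
  then show "\<forall>i<k. coeff p i = 0" by (simp add: coeff_monom_mult)
next
  assume "\<forall>i<k. coeff p i = 0"
  then show "[:0, 1:] ^ k dvd p"
    by (metis monom_1_dvd_iff' monom_altdef smult_1_left)
qed

text \<open>The restriction to the line is a nonzero polynomial \<open>g\<close> of degree at most
  \<open>n\<close>. Weights at the points u + t w are bounded by root orders, which add up to at
  most \<open>degree g\<close>; the weight at \<open>w\<close> is bounded by the degree drop
  \<open>n - degree g\<close>.\<close>

lemma weighted_line_bound:
  fixes f :: "'a::{finite,field} poly poly"
  assumes c: "c \<in> pts" "\<not> line c \<subseteq> zs n f"
    and wt: "\<And>P Q. P \<in> line c \<inter> zs n f \<Longrightarrow> Q \<in> line c \<Longrightarrow> [:0, 1:] ^ wt P dvd lnp n f P Q"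
  shows "(\<Sum>P\<in>line c \<inter> zs n f. wt P) \<le> n"
proof -
  obtain u w where uw: "u \<in> pts" "w \<in> pts" "inj (\<lambda>t. comb 1 u t w)" "w \<notin> range (\<lambda>t. comb 1 u t w)"
    "line c = insert w (range (\<lambda>t. comb 1 u t w))" using line_param[OF c(1)] by metis
  define g where "g = lnp n f u w"
  have gw: "coeff g n = ev n f w"
    using coeff_lnp_swap[of n n f u w] coeff_0_lnp[of n f w u] coeff_lnp_swap[of 0 n f w u]
    by (simp add: g_def)
  have gt: "poly g t = ev n f (comb 1 u t w)" for t by (simp add: g_def poly_lnp)
  have g0: "g \<noteq> 0"
  proof
    assume "g = 0"
    then have "\<And>t. ev n f (comb 1 u t w) = 0" "ev n f w = 0" using gt gw by (metis poly_0, metis coeff_0)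
    then have "line c \<subseteq> zs n f" using uw(5) by (auto simp: zs_def line_def)
    with c(2) show False by simp
  qed
  define R where "R = {t. poly g t = 0}"
  let ?p = "\<lambda>t. comb 1 u t w"
  have u_line: "u \<in> line c"
  proof -
    have "u = ?p 0" by (cases u; cases w) simp
    then show ?thesis using uw(5) by (metis insertCI rangeI)
  qed
  have pts: "?p t \<in> pts" for t using uw(5) by (auto simp: line_def)
  have ordt: "wt (?p t) \<le> Polynomial.order t g" if "t \<in> R" for t
  proof -
    have "?p t \<in> line c \<inter> zs n f" using that uw(5) pts by (auto simp: R_def gt zs_def)
    then have "[:0, 1:] ^ wt (?p t) dvd lnp n f (?p t) w" using wt uw(5) by blast
    then have "[:0, 1:] ^ wt (?p t) dvd pcompose g [:t, 1:]" by (simp only: lnp_shift g_def)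
    then obtain h where h: "pcompose g [:t, 1:] = [:0, 1:] ^ wt (?p t) * h" by blast
    \<comment> \<open>The shifted restriction has its root at 0; substituting back carries the
      divisibility to the root \<open>t\<close> of \<open>g\<close>.\<close>
    have "pcompose (pcompose g [:t, 1:]) [:-t, 1:] = [:-t, 1:] ^ wt (?p t) * pcompose h [:-t, 1:]"
      unfolding h by (simp add: pcompose_mult pcompose_power pcompose_pCons)
    moreover have "pcompose (pcompose g [:t, 1:]) [:-t, 1:] = g"
      using pcompose_idR[of g] by (simp add: pcompose_assoc[symmetric] pcompose_pCons)
    ultimately have "g = [:-t, 1:] ^ wt (?p t) * pcompose h [:-t, 1:]" by (simp only:)
    then have "[:-t, 1:] ^ wt (?p t) dvd g" by (metis dvd_triv_left)
    then show ?thesis using g0 unfolding order_divides by blast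
  qed
  have fin: "finite R" unfolding R_def by (rule poly_roots_finite[OF g0])
  have "(\<Sum>t\<in>R. wt (?p t)) \<le> (\<Sum>t\<in>R. Polynomial.order t g)" by (intro sum_mono ordt)
  also have "\<dots> \<le> degree g" unfolding R_def by (rule sum_order_le_degree[OF g0])
  finally have aff: "(\<Sum>t\<in>R. wt (?p t)) \<le> degree g" .
  have eqaff: "(\<Sum>P\<in>?p ` R. wt P) = (\<Sum>t\<in>R. wt (?p t))"
    by (subst sum.reindex) (use uw(3) in \<open>auto simp: inj_on_def\<close>)
  have split: "line c \<inter> zs n f = ?p ` R \<union> (if w \<in> zs n f then {w} else {})"
    using uw(5) pts by (auto simp: R_def gt zs_def)
  show ?thesis
  proof (cases "w \<in> zs n f")
    case False
    then have "line c \<inter> zs n f = ?p ` R" using split by simp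
    then have "(\<Sum>P\<in>line c \<inter> zs n f. wt P) \<le> degree g" using aff eqaff by simp
    also have "\<dots> \<le> n" unfolding g_def by (rule degree_lnp)
    finally show ?thesis .
  next
    case True
    have "[:0, 1:] ^ wt w dvd lnp n f w u" using wt u_line True uw(5) by blast
    then obtain h where h: "lnp n f w u = monom 1 (wt w) * h" by (auto simp: monom_altdef)
    have low: "coeff (lnp n f w u) k = 0" if "k < wt w" for k
      using that by (simp add: h coeff_monom_mult)
    \<comment> \<open>By reversal, the coefficient of index \<open>n - degree g\<close> seen from
      \<open>w\<close> is the leading coefficient of \<open>g\<close>, so the order of vanishing at
      \<open>w\<close> cannot exceed this index.\<close>
    have "degree g + wt w \<le> n"
    proof (rule ccontr)
      assume *: "\<not> degree g + wt w \<le> n"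
      have dn: "degree g \<le> n" unfolding g_def by (rule degree_lnp)
      have "coeff (lnp n f w u) (n - degree g) = 0" using * dn by (intro low) linarith
      moreover have "coeff (lnp n f w u) (n - degree g) = coeff g (degree g)"
        using coeff_lnp_swap[of "n - degree g" n f w u] dn by (simp add: g_def)
      ultimately show False using g0 by simp
    qed
    moreover have "(\<Sum>P\<in>line c \<inter> zs n f. wt P) = (\<Sum>P\<in>?p ` R. wt P) + wt w"
    proof -
      have "line c \<inter> zs n f = insert w (?p ` R)" using split True by simp
      moreover have "w \<notin> ?p ` R" using uw(4) by auto
      ultimately show ?thesis using fin by simp
    qed
    ultimately show ?thesis using aff eqaff by linarith
  qed
qed

lemma lineless_line_bound:
  fixes f :: "'a::{finite,field} poly poly"
  assumes "lineless n f" "c \<in> pts"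
  shows "card (line c \<inter> zs n f) \<le> n"
proof -
  have "(\<Sum>P\<in>line c \<inter> zs n f. 1) \<le> n"
  proof (rule weighted_line_bound)
    fix P Q assume "P \<in> line c \<inter> zs n f"
    then show "[:0, 1:] ^ 1 dvd lnp n f P Q"
      unfolding X_power_dvd_iff by (simp add: coeff_0_lnp zs_def)
  qed (use assms in \<open>auto simp: lineless_def\<close>)
  then show ?thesis by simp
qed

lemma weighted_point_line_count:
  fixes f :: "'a::{finite,field} poly poly"
  defines "q \<equiv> card (UNIV :: 'a set)"
  assumes f: "lineless n f"
    and wt: "\<And>c P Q. c \<in> pts \<Longrightarrow> P \<in> line c \<inter> zs n f \<Longrightarrow> Q \<in> line c \<Longrightarrow> [:0, 1:] ^ wt P c dvd lnp n f P Q"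
    and K: "\<And>P. P \<in> zs n f \<Longrightarrow> K \<le> (\<Sum>c\<in>{c \<in> pts. P \<in> line c}. wt P c)"
    and M: "M \<subseteq> pts" "\<And>c. c \<in> M \<Longrightarrow> line c \<inter> zs n f = {}"
  shows "K * card (zs n f) \<le> n * (q\<^sup>2 + q + 1 - card M)"
proof -
  have "K * card (zs n f) = (\<Sum>P\<in>zs n f. K)" by simp
  also have "\<dots> \<le> (\<Sum>P\<in>zs n f. \<Sum>c\<in>{c \<in> pts. P \<in> line c}. wt P c)" by (intro sum_mono K)
  also have "\<dots> = (\<Sum>c\<in>pts. \<Sum>P\<in>{P \<in> zs n f. P \<in> line c}. wt P c)"
    by (rule sum.swap_restrict) simp_all
  also have "\<dots> = (\<Sum>c\<in>pts. \<Sum>P\<in>line c \<inter> zs n f. wt P c)"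
    by (intro sum.cong) auto
  also have "\<dots> = (\<Sum>c\<in>pts - M. \<Sum>P\<in>line c \<inter> zs n f. wt P c)"
  proof (rule sum.mono_neutral_right)
    show "\<forall>c\<in>pts - (pts - M). (\<Sum>P\<in>line c \<inter> zs n f. wt P c) = 0"
      using M(2) by (metis Diff_iff sum.empty)
  qed auto
  also have "\<dots> \<le> (\<Sum>c\<in>pts - M. n)"
    by (intro sum_mono weighted_line_bound) (use f wt in \<open>auto simp: lineless_def\<close>)
  also have "\<dots> = n * (q\<^sup>2 + q + 1 - card M)"
    using M(1) card_pts[where ?'a = 'a] by (simp add: card_Diff_subset q_def)
  finally show ?thesis .
qed

section \<open>Gradients and tangent lines\<close>

definition grad :: "nat \<Rightarrow> 'a::field poly poly \<Rightarrow> 'a vec3 \<Rightarrow> 'a vec3" where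
  "grad n f P = (ev n (dx f) P, ev n (dy f) P, ev n (dz (Suc n) f) P)"

lemma coeff_1_lnp: "coeff (lnp (Suc n) f P v) 1 = dot (grad n f P) v"
proof -
  obtain a b c a' b' c' where uw: "P = (a, b, c)" "v = (a', b', c')" by (metis prod.exhaust)
  have "coeff (lnp (Suc n) f P v) 1 = poly (pderiv (lnp (Suc n) f P v)) 0"
    by (simp add: coeff_pderiv poly_0_coeff_0)
  then show ?thesis
    by (simp add: uw pderiv_hev pderiv_pCons grad_def poly_hev)
qed

lemma dot_grad_self:
  assumes "f \<in> form (Suc n)"
  shows "dot (grad n f P) P = of_nat (Suc n) * ev (Suc n) f P"
proof -
  obtain a b c where P: "P = (a, b, c)" by (metis prod.exhaust)
  have "poly ([:a:] * hev n (dx f) [:a:] [:b:] [:c:] + [:b:] * hev n (dy f) [:a:] [:b:] [:c:] +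
      [:c:] * hev n (dz (Suc n) f) [:a:] [:b:] [:c:]) 0 = poly (of_nat (Suc n) * hev (Suc n) f [:a:] [:b:] [:c:]) 0"
    by (simp only: euler_hev[OF assms])
  then show ?thesis by (simp add: P grad_def of_nat_poly algebra_simps del: of_nat_Suc)
qed

text \<open>For a zero gradient \<open>G\<close> any line through \<open>P\<close> qualifies;
  otherwise \<open>G\<close>, normalized, is itself the tangent line.\<close>

lemma tangent_line_exists:
  fixes P :: "'a::{finite,field} vec3"
  assumes "P \<in> pts" "dot G P = 0"
  obtains c where "c \<in> pts" "P \<in> line c" "\<And>Q. dot c Q = 0 \<Longrightarrow> dot G Q = 0"
proof (cases "G = (0, 0, 0)")
  case True
  define Q :: "'a vec3" where "Q = (if P = (1, 0, 0) then (0, 1, 0) else (1, 0, 0))"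
  have "Q \<in> pts" "P \<noteq> Q" by (auto simp: Q_def)
  then obtain c where "c \<in> pts" "dot c P = 0" using join_ex1[of P Q] assms(1) by blast
  moreover have "dot G R = 0" for R using True by (cases R) simp
  ultimately show ?thesis using that assms(1) by (auto simp: line_def)
next
  case False
  then obtain s c where "s \<noteq> 0" "c \<in> pts" "G = scale s c" by (rule normalize)
  then show ?thesis using that[of c] assms by (auto simp: line_def dot_scale)
qed

lemma card_lines_through:
  fixes P :: "'a::{finite,field} vec3"
  assumes "P \<in> pts"
  shows "card {c \<in> pts. P \<in> line c} = card (UNIV :: 'a set) + 1"
proof -
  have "{c \<in> pts. P \<in> line c} = line P" using assms by (auto simp: line_def dot_commute)
  then show ?thesis using card_line[OF assms] by simp
qed

text \<open>\<open>Suc k\<close> is the order of contact of the tangents at smooth points: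
  \<open>k = 1\<close> is always available, \<open>k = 2\<close> if these points are flexes. A
  smooth point carries weight \<open>q\<close> from its other lines and \<open>Suc k\<close> from
  its tangent; a singular point carries 2 on each of \<open>q + 1\<close> lines, which suffices as
  \<open>k \<le> q\<close>.\<close>

lemma tangent_count:
  fixes f :: "'a::{finite,field} poly poly"
  defines "q \<equiv> card (UNIV :: 'a set)"
  assumes f: "f \<in> form (Suc n)" "lineless (Suc n) f" and k: "1 \<le> k" "k \<le> q"
    and flex: "\<And>P v. P \<in> zs (Suc n) f \<Longrightarrow> grad n f P \<noteq> (0, 0, 0) \<Longrightarrow> dot (grad n f P) v = 0 \<Longrightarrow>
        [:0, 1:] ^ Suc k dvd lnp (Suc n) f P v"
    and M: "M \<subseteq> pts" "\<And>c. c \<in> M \<Longrightarrow> line c \<inter> zs (Suc n) f = {}"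
  shows "(q + 1 + k) * card (zs (Suc n) f) \<le> Suc n * (q\<^sup>2 + q + 1 - card M)"
proof -
  let ?G = "grad n f"
  define tan where "tan P c \<longleftrightarrow> (\<forall>Q. dot c Q = 0 \<longrightarrow> dot (?G P) Q = 0)" for P c
  define wt where "wt P c = (if ?G P = (0, 0, 0) then 2 else if tan P c then Suc k else 1)" for P c
  show ?thesis
  proof (rule weighted_point_line_count[OF f(2) _ _ M, where wt = wt, folded q_def])
    fix c P Q assume c: "c \<in> (pts :: 'a vec3 set)" and P: "P \<in> line c \<inter> zs (Suc n) f" and Q: "Q \<in> line c"
    have c0: "coeff (lnp (Suc n) f P Q) 0 = 0" using P by (simp add: coeff_0_lnp zs_def)
    show "[:0, 1:] ^ wt P c dvd lnp (Suc n) f P Q"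
    proof (cases "?G P = (0, 0, 0)")
      case True
      have "coeff (lnp (Suc n) f P Q) 1 = 0" unfolding coeff_1_lnp True by (cases Q) simp
      then show ?thesis using True c0 unfolding X_power_dvd_iff wt_def by (auto simp: less_2_cases_iff)
    next
      case False
      show ?thesis
      proof (cases "tan P c")
        case True
        then have "dot (?G P) Q = 0" using Q unfolding tan_def line_def by blast
        then have "[:0, 1:] ^ Suc k dvd lnp (Suc n) f P Q" using flex P False by blast
        then show ?thesis unfolding wt_def using False True by simp
      next
        case nt: False
        have "[:0, 1:] ^ Suc 0 dvd lnp (Suc n) f P Q" unfolding X_power_dvd_iff using c0 by simp
        then show ?thesis using False nt by (simp add: wt_def)
      qed
    qed
  next
    fix P assume P: "P \<in> zs (Suc n) f"
    then have Pp: "P \<in> pts" and P0: "ev (Suc n) f P = 0" by (auto simp: zs_def)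
    let ?L = "{c \<in> pts. P \<in> line c}"
    have cL: "card ?L = q + 1" unfolding q_def by (rule card_lines_through[OF Pp])
    show "q + 1 + k \<le> (\<Sum>c\<in>?L. wt P c)"
    proof (cases "?G P = (0, 0, 0)")
      case True
      then have "(\<Sum>c\<in>?L. wt P c) = (\<Sum>c\<in>?L. 2)" unfolding wt_def by simp
      also have "\<dots> = 2 * (q + 1)" using cL by simp
      finally show ?thesis using k by simp
    next
      case False
      have "dot (?G P) P = 0" using dot_grad_self[OF f(1), of P] P0 by simp
      then obtain c where "c \<in> pts" "P \<in> line c" "\<And>Q. dot c Q = 0 \<Longrightarrow> dot (?G P) Q = 0"
        using tangent_line_exists[OF Pp] by metis
      then have c: "c \<in> ?L" "tan P c" unfolding tan_def by blast+
      have "(\<Sum>c\<in>?L. wt P c) = wt P c + (\<Sum>c\<in>?L - {c}. wt P c)"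
        by (rule sum.remove) (use c in auto)
      also have "wt P c = Suc k" using c False by (simp add: wt_def)
      finally have "(\<Sum>c\<in>?L. wt P c) = Suc k + (\<Sum>c\<in>?L - {c}. wt P c)" .
      moreover have "(\<Sum>c\<in>?L - {c}. 1) \<le> (\<Sum>c\<in>?L - {c}. wt P c)"
        by (rule sum_mono) (simp add: wt_def)
      moreover have "(\<Sum>c\<in>?L - {c}. 1) = q" using cL c(1) by (simp add: card_Diff_singleton)
      ultimately show ?thesis by simp
    qed
  qed
qed

lemma tangent_count_2:
  fixes f :: "'a::{finite,field} poly poly"
  defines "q \<equiv> card (UNIV :: 'a set)"
  assumes f: "f \<in> form (Suc n)" "lineless (Suc n) f"
  shows "(q + 2) * card (zs (Suc n) f) \<le> Suc n * (q\<^sup>2 + q + 1)"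
proof -
  have "1 \<le> q" unfolding q_def using finite_UNIV_card_ge_0[where ?'a = 'a] by simp
  then have "(q + 1 + 1) * card (zs (Suc n) f) \<le> Suc n * (q\<^sup>2 + q + 1 - card ({} :: 'a vec3 set))"
  proof (intro tangent_count[OF f, folded q_def], goal_cases)
    case (3 P v)
    have "coeff (lnp (Suc n) f P v) 0 = 0" using 3(2) by (simp add: coeff_0_lnp zs_def)
    moreover have "coeff (lnp (Suc n) f P v) 1 = 0" using 3(4) by (simp only: coeff_1_lnp)
    ultimately show ?case unfolding X_power_dvd_iff by (auto simp: less_Suc_eq)
  qed auto
  then show ?thesis by simp
qed

text \<open>If the Frobenius polar of \<open>f\<close> is a multiple of \<open>f\<close>, comparing the Taylor coefficients
  of both sides at a smooth rational point in a transversal and in the tangent direction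
  shows that the point is a flex.\<close>

lemma frobenius_nonclassical_flex:
  fixes f :: "'a::{finite,field} poly poly"
  defines "q \<equiv> card (UNIV :: 'a set)"
  assumes f: "f \<in> form (Suc n)" and A: "A \<in> form (q - 1)" "frob q (Suc n) f = f * A" and q: "3 \<le> q"
    and P: "ev (Suc n) f P = 0" and G: "grad n f P \<noteq> (0, 0, 0)" and v: "dot (grad n f P) v = 0"
  shows "[:0, 1:] ^ 3 dvd lnp (Suc n) f P v"
proof -
  have key: "lnp (Suc n) f P x * lnp (q - 1) A P x =
     of_nat (Suc n) * lnp (Suc n) f P x + (monom 1 q - monom 1 1) * pderiv (lnp (Suc n) f P x)" for x
  proof -
    have e: "Suc n + (q - 1) = q + n" using q by simp
    have "lnp (q + n) (frob q (Suc n) f) P x = lnp (Suc n) f P x * lnp (q - 1) A P x"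
      unfolding A(2) e[symmetric] by (rule lnp_mult[OF f A(1)])
    then show ?thesis
      using lnp_frob[OF f, of P x] unfolding q_def by (simp add: monom_altdef)
  qed
  have cN: "coeff (of_nat (Suc n) * p) k = of_nat (Suc n) * coeff p k" for p :: "'a poly" and k
    by (simp add: of_nat_poly del: of_nat_Suc)
  \<comment> \<open>Below degree q the factor t^q - t acts as -t. The indices needed are 1 and 2,
    whence \<open>3 \<le> q\<close>.\<close>
  have cD: "coeff ((monom 1 q - monom 1 1) * p) k = - (if k = 0 then 0 else coeff p (k - 1))"
    if "k < q" for p :: "'a poly" and k
    using that by (simp add: left_diff_distrib coeff_monom_mult del: One_nat_def)
  let ?a = "ev (q - 1) A P" and ?N = "of_nat (Suc n) :: 'a"
  have c0: "coeff (lnp (Suc n) f P x) 0 = 0" for x using P by (simp add: coeff_0_lnp)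
  \<comment> \<open>A transversal direction has a nonzero coefficient of t, which forces the value
    of \<open>A\<close> at \<open>P\<close>.\<close>
  have a: "?a = ?N - 1"
  proof -
    obtain x where x: "dot (grad n f P) x \<noteq> 0"
    proof -
      obtain g1 g2 g3 where g: "grad n f P = (g1, g2, g3)" by (metis prod.exhaust)
      then have "dot (grad n f P) (1, 0, 0) \<noteq> 0 \<or> dot (grad n f P) (0, 1, 0) \<noteq> 0 \<or> dot (grad n f P) (0, 0, 1) \<noteq> 0"
        using G by auto
      then show ?thesis using that by blast
    qed
    let ?g = "lnp (Suc n) f P x"
    have "coeff (?g * lnp (q - 1) A P x) 1 = coeff ?g 1 * ?a"
      using c0[of x] coeff_0_lnp[of "q - 1" A P x] by (simp add: coeff_mult)
    moreover have "coeff (?g * lnp (q - 1) A P x) 1 = ?N * coeff ?g 1 - coeff ?g 1"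
      unfolding key coeff_add cN using cD[of 1] q by (simp add: coeff_pderiv)
    ultimately have "coeff ?g 1 * ?a = coeff ?g 1 * (?N - 1)" by (simp add: algebra_simps)
    then show ?thesis using x coeff_1_lnp[of n f P x] by simp
  qed
  let ?g = "lnp (Suc n) f P v"
  have c1: "coeff ?g 1 = 0" using v by (simp only: coeff_1_lnp)
  have "coeff (?g * lnp (q - 1) A P v) 2 = coeff ?g 2 * ?a"
    using c1 c0[of v] coeff_0_lnp[of "q - 1" A P v] by (simp add: coeff_mult numeral_2_eq_2)
  moreover have "coeff (?g * lnp (q - 1) A P v) 2 = ?N * coeff ?g 2 - 2 * coeff ?g 2"
    unfolding key coeff_add cN using cD[of 2] q by (simp add: coeff_pderiv numeral_2_eq_2)
  \<comment> \<open>The two multipliers of \<open>coeff ?g 2\<close> differ by 1, so it vanishes in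
    every characteristic, including 2.\<close>
  ultimately have "coeff ?g 2 * (?N - 1) = coeff ?g 2 * (?N - 2)" unfolding a by (simp add: algebra_simps)
  then have "coeff ?g 2 = 0" by (simp add: algebra_simps)
  then show ?thesis using c0 c1 unfolding X_power_dvd_iff
    by (auto simp: eval_nat_numeral less_Suc_eq)
qed

section \<open>Bezout's inequality with tangency conditions\<close>

lemma card_tri: "2 * card (tri n) = (n + 1) * (n + 2)"
proof (induction n)
  case 0 show ?case by (simp add: tri_def)
next
  case (Suc n)
  have "tri (Suc n) = tri n \<union> (\<lambda>i. (i, Suc n - i)) ` {..Suc n}"
    by (auto simp: tri_def image_iff)
  moreover have "card (tri n \<union> (\<lambda>i. (i, Suc n - i)) ` {..Suc n}) =
      card (tri n) + card ((\<lambda>i. (i, Suc n - i)) ` {..Suc n})"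
    by (rule card_Un_disjoint[OF finite_tri]) (auto simp: tri_def)
  moreover have "card ((\<lambda>i. (i, Suc n - i)) ` {..Suc n}) = Suc (Suc n)"
    by (subst card_image) (auto simp: inj_on_def)
  ultimately show ?case using Suc by simp
qed

text \<open>Sizes replace dimensions: the exponent of q is the dimension of the space of
  forms.\<close>

lemma card_form:
  "card (form n :: 'a::{finite,field} poly poly set) = card (UNIV :: 'a set) ^ card (tri n)"
proof -
  let ?B = "tri n \<rightarrow>\<^sub>E (UNIV :: 'a set)"
  let ?h = "\<lambda>f :: 'a poly poly. restrict (\<lambda>(i, j). cf f i j) (tri n)"
  have "bij_betw ?h (form n) ?B"
  proof (rule bij_betw_imageI)
    show "inj_on ?h (form n)"
    proof (rule inj_onI)
      fix f g :: "'a poly poly" assume fg: "f \<in> form n" "g \<in> form n" "?h f = ?h g"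
      have "cf f i j = cf g i j" for i j
      proof (cases "(i, j) \<in> tri n")
        case True
        then have "?h f (i, j) = cf f i j" "?h g (i, j) = cf g i j" by simp_all
        then show ?thesis using fg(3) by metis
      next
        case False
        then show ?thesis using formD fg(1,2) by (metis mem_tri not_le)
      qed
      then show "f = g" by (intro poly_eqI)
    qed
    show "?h ` form n = ?B"
    proof (intro equalityI subsetI)
      fix \<phi> assume \<phi>: "\<phi> \<in> ?B"
      define f where "f = (\<Sum>p\<in>tri n. monom (monom (\<phi> p) (fst p)) (snd p))"
      have cff: "cf f i j = (if (i, j) \<in> tri n then \<phi> (i, j) else 0)" for i j
      proof -
        have "cf f i j = (\<Sum>p\<in>tri n. if p = (i, j) then \<phi> (i, j) else 0)"
          unfolding f_def coeff_sum by (intro sum.cong) (auto simp: prod_eq_iff)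
        then show ?thesis by simp
      qed
      then have "f \<in> form n" by (auto simp: form_def mem_tri)
      moreover have "?h f = \<phi>"
        using \<phi> by (auto simp: cff fun_eq_iff restrict_def PiE_def extensional_def)
      ultimately show "\<phi> \<in> ?h ` form n" by blast
    qed auto
  qed
  then show ?thesis by (simp add: bij_betw_same_card card_PiE)
qed

lemma finite_form [simp]: "finite (form n :: 'a::{finite,field} poly poly set)"
  using card_form[of n, where ?'a = 'a] finite_UNIV_card_ge_0[where ?'a = 'a]
  by (intro card_ge_0_finite) simp

section \<open>Interpolation of values and directional derivatives\<close>

fun lform :: "'a::field vec3 \<Rightarrow> 'a poly poly" where
  "lform (a, b, c) = [:[:c, a:], [:b:]:]"

lemma form_lform: "lform a \<in> form 1"
  by (cases a) (auto simp: form_def coeff_pCons split: nat.split)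

lemma lnp_lform: "lnp (Suc 0) (lform a) P v = [:dot a P, dot a v:]"
  by (cases a; cases P; cases v) (simp add: hev_def tri_1 algebra_simps)

lemma ev_lform: "ev (Suc 0) (lform a) P = dot a P"
  using coeff_0_lnp[of "Suc 0" "lform a" P P] by (simp add: lnp_lform)

text \<open>Since \<open>P\<close> and \<open>v\<close> are independent, some coordinate vector w
  has det(v, w, P) \<noteq> 0; the functional det(v, w, .), rescaled, is the required one.\<close>

lemma separating_vector:
  assumes "cross P v \<noteq> (0, 0, 0)"
  obtains a where "dot a P = 1" "dot a v = 0"
proof -
  obtain p1 p2 p3 where P: "P = (p1, p2, p3)" by (metis prod.exhaust)
  obtain v1 v2 v3 where v: "v = (v1, v2, v3)" by (metis prod.exhaust)
  define w :: "'a vec3" where "w = (if p2 * v3 - p3 * v2 \<noteq> 0 then (1, 0, 0)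
     else if p3 * v1 - p1 * v3 \<noteq> 0 then (0, 1, 0) else (0, 0, 1))"
  define D where "D = dot (cross v w) P"
  have "D = dot w (cross P v)" by (cases w) (simp add: D_def P v algebra_simps)
  also have "\<dots> \<noteq> 0" using assms by (auto simp: w_def P v)
  finally have D: "D \<noteq> 0" .
  show ?thesis
  proof (rule that[of "scale (1 / D) (cross v w)"])
    show "dot (scale (1 / D) (cross v w)) P = 1" using D by (simp add: dot_scale D_def)
    show "dot (scale (1 / D) (cross v w)) v = 0" by (simp add: dot_scale dot_cross)
  qed
qed

lemma cross_swap: "cross v P = (0, 0, 0) \<longleftrightarrow> cross P v = (0, 0, 0)"
  by (cases P; cases v) (auto simp: algebra_simps)

text \<open>Multiply the squares of linear forms, one through each point of \<open>T\<close>, all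
  avoiding \<open>P\<close>. A square vanishes to order 2 in every direction at its point.\<close>

lemma double_vanishing_form:
  fixes P :: "'a::{finite,field} vec3"
  assumes "finite T" "T \<subseteq> pts" "P \<in> pts" "P \<notin> T"
  shows "\<exists>W\<in>form (2 * card T). ev (2 * card T) W P \<noteq> 0 \<and>
    (\<forall>Q\<in>T. \<forall>x. [:0, 1:] ^ 2 dvd lnp (2 * card T) W Q x)"
  using assms
proof (induction T)
  case empty
  have "ev 0 1 P = 1" by (cases P) (simp add: hev_def tri_def)
  then show ?case by (intro bexI[of _ 1]) (simp_all add: form_1)
next
  case (insert R T)
  have "\<exists>W\<in>form (2 * card T). ev (2 * card T) W P \<noteq> 0 \<and>
    (\<forall>Q\<in>T. \<forall>x. [:0, 1:] ^ 2 dvd lnp (2 * card T) W Q x)"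
    by (rule insert.IH) (use insert.prems in auto)
  then obtain W where W: "W \<in> form (2 * card T)" "ev (2 * card T) W P \<noteq> 0"
    "\<And>Q x. Q \<in> T \<Longrightarrow> [:0, 1:] ^ 2 dvd lnp (2 * card T) W Q x" by blast
  have "cross P R \<noteq> (0, 0, 0)" using cross_pts_eq[of P R] insert.prems by auto
  then obtain a where a: "dot a P = 1" "dot a R = 0" by (rule separating_vector)
  let ?L = "lform a"
  have LL: "?L * ?L \<in> form 2" using form_mult[OF form_lform form_lform, of a a] by (simp add: numeral_2_eq_2)
  have n: "2 * card (insert R T) = 2 + 2 * card T" using insert.hyps by simp
  have lnpLL: "lnp 2 (?L * ?L) Q x = [:dot a Q, dot a x:] * [:dot a Q, dot a x:]" for Q x
    using lnp_mult[OF form_lform form_lform, of a a Q x] unfolding one_add_one One_nat_def lnp_lform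
    by (simp add: numeral_2_eq_2)
  show ?case unfolding n
  proof (intro bexI[of _ "?L * ?L * W"] conjI ballI allI)
    show mem: "?L * ?L * W \<in> form (2 + 2 * card T)" by (rule form_mult[OF LL W(1)])
    have "ev 2 (?L * ?L) P = 1"
      using coeff_0_lnp[of 2 "?L * ?L" P P] unfolding lnpLL a by simp
    then show "ev (2 + 2 * card T) (?L * ?L * W) P \<noteq> 0"
      using W(2) by (simp only: ev_mult[OF LL W(1)]) simp
    fix Q x assume Q: "Q \<in> insert R T"
    show "[:0, 1:] ^ 2 dvd lnp (2 + 2 * card T) (?L * ?L * W) Q x"
    proof (cases "Q = R")
      case True
      have "[:0, dot a x:] * [:0, dot a x:] = [:0, 1:] ^ 2 * [:dot a x * dot a x:]"
        by (simp add: power2_eq_square)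
      then have "[:0, 1:] ^ 2 dvd lnp 2 (?L * ?L) Q x" unfolding True lnpLL a by (metis dvd_triv_left)
      then show ?thesis unfolding lnp_mult[OF LL W(1)] by (rule dvd_mult2)
    next
      case False
      then have "[:0, 1:] ^ 2 dvd lnp (2 * card T) W Q x" using Q W(3) by blast
      then show ?thesis unfolding lnp_mult[OF LL W(1)] by (rule dvd_mult)
    qed
  qed
qed

text \<open>As in Lagrange interpolation, each point gets a form with the prescribed value and
  derivative there and with zero data at all other points; these forms are summed.\<close>

lemma hermite_interpolation:
  fixes S :: "'a::{finite,field} vec3 set"
  assumes S: "S \<subseteq> pts" and v: "\<And>P. P \<in> S \<Longrightarrow> cross P (v P) \<noteq> (0, 0, 0)" and m: "2 * card S < m"
  shows "\<exists>W\<in>form m. \<forall>P\<in>S. coeff (lnp m W P (v P)) 0 = \<alpha> P \<and> coeff (lnp m W P (v P)) 1 = \<beta> P"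
proof -
  have single: "\<exists>W\<in>form m. coeff (lnp m W P (v P)) 0 = \<alpha> P \<and> coeff (lnp m W P (v P)) 1 = \<beta> P \<and>
      (\<forall>Q\<in>S - {P}. [:0, 1:] ^ 2 dvd lnp m W Q (v Q))" if P: "P \<in> S" for P
  proof -
    define T where "T = S - {P}"
    \<comment> \<open>Degree budget: 2 for each other point and 1 for a linear form carrying the two
      prescribed numbers; the \<open>k\<close>-th power of a linear form with value 1 at
      \<open>P\<close> fills up the rest.\<close>
    define k where "k = m - 1 - 2 * card T"
    have "card T < card S" unfolding T_def using P by (intro psubset_card_mono) auto
    then have mk: "m = Suc 0 + (k + 2 * card T)" using m by (simp add: k_def)
    have "T \<subseteq> pts" "P \<in> pts" "P \<notin> T" using S P by (auto simp: T_def)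
    from double_vanishing_form[OF finite_vec3 this]
    obtain W where W: "W \<in> form (2 * card T)" "ev (2 * card T) W P \<noteq> 0"
      "\<And>Q x. Q \<in> T \<Longrightarrow> [:0, 1:] ^ 2 dvd lnp (2 * card T) W Q x" by blast
    obtain a where a: "dot a P = 1" "dot a (v P) = 0" using separating_vector v P by metis
    obtain b where b: "dot b (v P) = 1" "dot b P = 0"
      using separating_vector[of "v P" P] cross_swap[of "v P" P] v P by metis
    have La: "lform a ^ k \<in> form k" using form_power[OF form_lform, of a k] by simp
    have lnpLa: "lnp k (lform a ^ k) Q x = [:dot a Q, dot a x:] ^ k" for Q x
    proof -
      obtain q1 q2 q3 x1 x2 x3 where Q: "Q = (q1, q2, q3)" "x = (x1, x2, x3)" by (metis prod.exhaust)
      have "lnp k (lform a ^ k) Q x = lnp 1 (lform a) Q x ^ k"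
        unfolding Q lnp.simps using hev_power[OF form_lform, of k a] by simp
      then show ?thesis by (simp add: lnp_lform)
    qed
    define W0 where "W0 = lform a ^ k * W"
    have W0: "W0 \<in> form (k + 2 * card T)" unfolding W0_def by (rule form_mult[OF La W(1)])
    have lnpW0: "lnp (k + 2 * card T) W0 Q x = [:dot a Q, dot a x:] ^ k * lnp (2 * card T) W Q x" for Q x
      unfolding W0_def lnp_mult[OF La W(1)] lnpLa ..
    define w0 where "w0 = coeff (lnp (k + 2 * card T) W0 P (v P)) 0"
    define w1 where "w1 = coeff (lnp (k + 2 * card T) W0 P (v P)) 1"
    have w0: "w0 \<noteq> 0" unfolding w0_def lnpW0 a using W(2) by (simp add: coeff_mult coeff_0_lnp)
    \<comment> \<open>\<open>r\<close> and \<open>s\<close> solve the triangular system r w0 =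
      \<alpha>, r w1 + s w0 = \<beta>, read off from the product of r + s t with w0 + w1 t +
      ...\<close>
    define r where "r = \<alpha> P / w0"
    define s where "s = (\<beta> P - w1 * r) / w0"
    define c where "c = comb r a s b"
    have dc: "dot c P = r" "dot c (v P) = s"
    proof -
      have "dot c x = r * dot a x + s * dot b x" for x
        unfolding c_def by (cases a; cases b; cases x) (simp add: algebra_simps)
      then show "dot c P = r" "dot c (v P) = s" using a b by simp_all
    qed
    let ?V = "lform c * W0"
    have Lc: "lform c \<in> form (Suc 0)" using form_lform[of c] by simp
    have V: "?V \<in> form m" unfolding mk by (rule form_mult[OF Lc W0])
    have lnpV: "lnp m ?V Q x = [:dot c Q, dot c x:] * lnp (k + 2 * card T) W0 Q x" for Q x
      unfolding mk lnp_mult[OF Lc W0] lnp_lform ..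
    show ?thesis
    proof (intro bexI[OF _ V] conjI ballI)
      show "coeff (lnp m ?V P (v P)) 0 = \<alpha> P"
        unfolding lnpV dc using w0 by (simp add: w0_def[symmetric] r_def)
      show "coeff (lnp m ?V P (v P)) 1 = \<beta> P"
        unfolding lnpV dc using w0 by (simp add: w0_def[symmetric] w1_def[unfolded One_nat_def, symmetric] s_def)
      fix Q assume "Q \<in> S - {P}"
      then show "[:0, 1:] ^ 2 dvd lnp m ?V Q (v Q)"
        unfolding lnpV lnpW0 by (intro dvd_mult W(3)) (simp add: T_def)
    qed
  qed
  then obtain V where V: "\<And>P. P \<in> S \<Longrightarrow> V P \<in> form m"
    "\<And>P. P \<in> S \<Longrightarrow> coeff (lnp m (V P) P (v P)) 0 = \<alpha> P \<and> coeff (lnp m (V P) P (v P)) 1 = \<beta> P"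
    "\<And>P Q. P \<in> S \<Longrightarrow> Q \<in> S - {P} \<Longrightarrow> [:0, 1:] ^ 2 dvd lnp m (V P) Q (v Q)"
    by metis
  have lnp_sum: "lnp m (\<Sum>P\<in>A. V P) Q x = (\<Sum>P\<in>A. lnp m (V P) Q x)" for A Q x
  proof (induction A rule: infinite_finite_induct)
    case empty show ?case by (cases Q; cases x) simp
  next
    case (infinite A) then show ?case by (cases Q; cases x) simp
  qed (simp add: lnp_add)
  have form_sum: "(\<Sum>P\<in>A. V P) \<in> form m" if "A \<subseteq> S" for A
    using that by (induction A rule: infinite_finite_induct) (auto intro: form_add V)
  show ?thesis
  proof (intro bexI[OF _ form_sum[OF order_refl]] ballI)
    fix Q assume Q: "Q \<in> S"
    have z: "coeff (lnp m (V P) Q (v Q)) i = 0" if "P \<in> S - {Q}" "i < 2" for P i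
      using V(3)[of P Q] that Q unfolding X_power_dvd_iff by blast
    have "(\<Sum>P\<in>S. coeff (lnp m (V P) Q (v Q)) i) = coeff (lnp m (V Q) Q (v Q)) i" if "i < 2" for i
    proof -
      have "(\<Sum>P\<in>S. coeff (lnp m (V P) Q (v Q)) i) =
         coeff (lnp m (V Q) Q (v Q)) i + (\<Sum>P\<in>S - {Q}. coeff (lnp m (V P) Q (v Q)) i)"
        by (rule sum.remove) (use Q in auto)
      also have "(\<Sum>P\<in>S - {Q}. coeff (lnp m (V P) Q (v Q)) i) = 0"
        using z that by (intro sum.neutral) blast
      finally show ?thesis by simp
    qed
    then show "coeff (lnp m (\<Sum>P\<in>S. V P) Q (v Q)) 0 = \<alpha> Q \<and> coeff (lnp m (\<Sum>P\<in>S. V P) Q (v Q)) 1 = \<beta> Q"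
      using V(2)[OF Q] by (simp add: lnp_sum coeff_sum)
  qed
qed

text \<open>Bezout's inequality by counting: the forms of large degree \<open>m\<close> in the ideal \<open>(f, g)\<close>
  number at least \<open>q ^ (dim R\<^sub>m - e * h)\<close>, and \<open>2 * card S\<close> independent conditions hold on them.\<close>

lemma tangential_bezout:
  fixes f g :: "'a::{finite,field} poly poly"
  assumes f: "exact e f" "prime_elem f" and g: "g \<in> form h" "\<not> f dvd g"
    and S: "S \<subseteq> pts" and v: "\<And>P. P \<in> S \<Longrightarrow> cross P (v P) \<noteq> (0, 0, 0)"
    and vf: "\<And>P. P \<in> S \<Longrightarrow> [:0, 1:] ^ 2 dvd lnp e f P (v P)"
    and vg: "\<And>P. P \<in> S \<Longrightarrow> [:0, 1:] ^ 2 dvd lnp h g P (v P)"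
  shows "2 * card S \<le> e * h"
proof -
  define q where "q = card (UNIV :: 'a set)"
  have "card {0, 1 :: 'a} \<le> q" unfolding q_def by (rule card_mono) auto
  then have q2: "1 < q" by simp
  define N where "N = card S"
  \<comment> \<open>Any \<open>k\<close> this large serves: it makes \<open>2 * N < m\<close> for
    the interpolation, and it cancels in the final count.\<close>
  define k where "k = 2 * N + 1"
  define m where "m = k + e + h"
  have f0: "f \<noteq> 0" using f(1) by (rule exact_nonzero)
  have ff: "f \<in> form e" using f(1) by blast
  define A where "A = (form (k + h) :: 'a poly poly set)"
  define B where "B = (form (k + e) :: 'a poly poly set)"
  define C where "C = (form k :: 'a poly poly set)"
  define I where "I = (\<lambda>(a, b). f * a + g * b) ` (A \<times> B)"
  have memI: "x \<in> form m \<and> (\<forall>P\<in>S. [:0, 1:] ^ 2 dvd lnp m x P (v P))" if "x \<in> I" for x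
  proof -
    from that obtain a b where ab: "a \<in> form (k + h)" "b \<in> form (k + e)" "x = f * a + g * b"
      by (auto simp: I_def A_def B_def)
    have m1: "m = e + (k + h)" and m2: "m = h + (k + e)" by (simp_all add: m_def)
    have 1: "f * a \<in> form m" unfolding m1 by (rule form_mult[OF ff ab(1)])
    have 2: "g * b \<in> form m" unfolding m2 by (rule form_mult[OF g(1) ab(2)])
    have "[:0, 1:] ^ 2 dvd lnp m (f * a) P (v P)" if "P \<in> S" for P
      unfolding m1 lnp_mult[OF ff ab(1)] using vf[OF that] by (rule dvd_mult2)
    moreover have "[:0, 1:] ^ 2 dvd lnp m (g * b) P (v P)" if "P \<in> S" for P
      unfolding m2 lnp_mult[OF g(1) ab(2)] using vg[OF that] by (rule dvd_mult2)
    ultimately show ?thesis using 1 2 by (auto simp: ab(3) lnp_add intro!: form_add dvd_add)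
  qed
  have finI: "finite I" by (simp add: I_def A_def B_def)
  \<comment> \<open>Every element of \<open>I\<close> has zero data at the points of
    \<open>S\<close>. Adding an interpolant for each of the \<open>q ^ (2 * N)\<close> possible data
    sets yields distinct forms of degree \<open>m\<close>.\<close>
  have upper: "card I * q ^ (2 * N) \<le> q ^ card (tri m)"
  proof -
    let ?F = "S \<rightarrow>\<^sub>E (UNIV :: ('a \<times> 'a) set)"
    define Wp where "Wp \<phi> w \<longleftrightarrow> w \<in> form m \<and> (\<forall>P\<in>S. coeff (lnp m w P (v P)) 0 = fst (\<phi> P) \<and>
        coeff (lnp m w P (v P)) 1 = snd (\<phi> P))" for \<phi> w
    have "2 * card S < m" by (simp add: m_def k_def N_def)
    then have "\<exists>w. Wp \<phi> w" for \<phi>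
      using hermite_interpolation[OF S v, of m "\<lambda>P. fst (\<phi> P)" "\<lambda>P. snd (\<phi> P)"]
      unfolding Wp_def by blast
    then obtain W where "\<And>\<phi>. Wp \<phi> (W \<phi>)" by metis
    then have W: "\<And>\<phi>. W \<phi> \<in> form m"
      "\<And>\<phi> P. P \<in> S \<Longrightarrow> coeff (lnp m (W \<phi>) P (v P)) 0 = fst (\<phi> P)"
      "\<And>\<phi> P. P \<in> S \<Longrightarrow> coeff (lnp m (W \<phi>) P (v P)) 1 = snd (\<phi> P)" unfolding Wp_def by blast+
    have cI: "coeff (lnp m (x + W \<phi>) P (v P)) 0 = fst (\<phi> P) \<and> coeff (lnp m (x + W \<phi>) P (v P)) 1 = snd (\<phi> P)"
      if "x \<in> I" "P \<in> S" for x P \<phi>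
      using memI[OF that(1)] that(2) W(2,3)[OF that(2), of \<phi>] unfolding X_power_dvd_iff lnp_add coeff_add by simp
    have "inj_on (\<lambda>(x, \<phi>). x + W \<phi>) (I \<times> ?F)"
    proof (rule inj_onI, clarify)
      fix x \<phi> y \<psi> assume *: "x \<in> I" "\<phi> \<in> ?F" "y \<in> I" "\<psi> \<in> ?F" "x + W \<phi> = y + W \<psi>"
      have "\<phi> P = \<psi> P" if "P \<in> S" for P
        using cI[OF *(1) that, of \<phi>] cI[OF *(3) that, of \<psi>] *(5) by (simp add: prod_eq_iff)
      then have "\<phi> = \<psi>" using *(2,4) by (intro PiE_ext)
      then show "x = y \<and> \<phi> = \<psi>" using *(5) by simp
    qed
    moreover have "(\<lambda>(x, \<phi>). x + W \<phi>) ` (I \<times> ?F) \<subseteq> form m"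
      using memI W(1) by (auto intro: form_add)
    ultimately have "card (I \<times> ?F) \<le> card (form m :: 'a poly poly set)"
      by (rule card_inj_on_le) simp
    moreover have "card ?F = q ^ (2 * N)"
      by (simp add: card_PiE N_def q_def power_mult power2_eq_square card_cartesian_product flip: UNIV_Times_UNIV)
    ultimately show ?thesis by (simp add: card_cartesian_product card_form q_def)
  qed
  \<comment> \<open>This bounds the fibres of (a, b) -> f a + g b: for a fixed image, b is
    determined modulo \<open>f\<close> because the prime \<open>f\<close> does not divide
    \<open>g\<close>, and the quotient is a form of degree \<open>k\<close>.\<close>
  have lower: "q ^ (card (tri (k + h)) + card (tri (k + e))) \<le> card I * q ^ card (tri k)"
  proof -
    have "\<forall>x\<in>I. \<exists>p. p \<in> A \<times> B \<and> x = f * fst p + g * snd p" by (auto simp: I_def)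
    then obtain r where r: "\<And>x. x \<in> I \<Longrightarrow> r x \<in> A \<times> B" "\<And>x. x \<in> I \<Longrightarrow> x = f * fst (r x) + g * snd (r x)"
      by metis
    let ?i = "\<lambda>p. f * fst p + g * snd p"
    have iI: "?i p \<in> I" if "p \<in> A \<times> B" for p using that by (auto simp: I_def)
    have "\<exists>c\<in>C. snd p - snd (r (?i p)) = f * c" if p: "p \<in> A \<times> B" for p
    proof -
      define b where "b = snd p - snd (r (?i p))"
      have "f * (fst (r (?i p)) - fst p) = g * b"
        using r(2)[OF iI[OF p]] by (simp add: b_def algebra_simps)
      then have "f dvd g * b" by (metis dvd_triv_left)
      then have "f dvd b" using f(2) g(2) by (metis prime_elem_dvd_multD)
      then obtain c where c: "b = f * c" by blast
      have "b \<in> form (k + e)" using r(1)[OF iI[OF p]] p unfolding b_def B_def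
        by (intro form_diff) auto
      then have "c \<in> C" unfolding C_def using form_cancel(2)[OF f(1), of c "k + e"] c by (cases "c = 0") simp_all
      then show ?thesis by (rule bexI[rotated]) (use c b_def in simp)
    qed
    then obtain c where c: "\<And>p. p \<in> A \<times> B \<Longrightarrow> c p \<in> C \<and> snd p - snd (r (?i p)) = f * c p" by metis
    have "inj_on (\<lambda>p. (?i p, c p)) (A \<times> B)"
    proof (rule inj_onI)
      fix p p' assume *: "p \<in> A \<times> B" "p' \<in> A \<times> B" "(?i p, c p) = (?i p', c p')"
      then have e: "?i p = ?i p'" "c p = c p'" by simp_all
      have "snd p = snd (r (?i p)) + f * c p" using c[OF *(1)] by (simp add: algebra_simps)
      also have "\<dots> = snd p'" using c[OF *(2)] unfolding e by (simp add: algebra_simps)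
      finally have s: "snd p = snd p'" .
      then have "fst p = fst p'" using e(1) f0 by simp
      with s show "p = p'" by (simp add: prod_eq_iff)
    qed
    moreover have "(\<lambda>p. (?i p, c p)) ` (A \<times> B) \<subseteq> I \<times> C" using iI c by blast
    ultimately have "card (A \<times> B) \<le> card (I \<times> C)"
      by (rule card_inj_on_le) (simp add: finI C_def)
    then show ?thesis by (simp add: card_cartesian_product A_def B_def C_def card_form q_def power_add)
  qed
  have "q ^ (card (tri (k + h)) + card (tri (k + e)) + 2 * N) \<le> card I * q ^ card (tri k) * q ^ (2 * N)"
    unfolding power_add[of q _ "2 * N"] by (rule mult_le_mono1[OF lower])
  also have "\<dots> \<le> q ^ card (tri m) * q ^ card (tri k)"
    using mult_le_mono1[OF upper, of "q ^ card (tri k)"] by (simp add: mult_ac)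
  finally have "q ^ (card (tri (k + h)) + card (tri (k + e)) + 2 * N) \<le> q ^ (card (tri m) + card (tri k))"
    by (simp add: power_add)
  then have "card (tri (k + h)) + card (tri (k + e)) + 2 * N \<le> card (tri m) + card (tri k)"
    using q2 by (simp add: power_increasing_iff)
  then have "(k + h + 1) * (k + h + 2) + (k + e + 1) * (k + e + 2) + 4 * N \<le>
     (k + e + h + 1) * (k + e + h + 2) + (k + 1) * (k + 2)"
    using card_tri[of "k + h"] card_tri[of "k + e"] card_tri[of m] card_tri[of k] unfolding m_def by linarith
  \<comment> \<open>The mixed second difference of n -> (n + 1) (n + 2) / 2 with steps e and h is e
    h, whatever \<open>k\<close> is.\<close>
  then have "4 * N \<le> 2 * (e * h)" by (simp add: algebra_simps)
  then show ?thesis by (simp add: N_def)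
qed

text \<open>Along a tangent direction at a rational point the restriction g of \<open>f\<close> has
  no terms below t^2. Neither has that of the Frobenius polar, which is a multiple of g plus (t^q -
  t) g'. Bezout then applies with degrees \<open>Suc n\<close> and \<open>q + n\<close>.\<close>

lemma frobenius_classical_bound:
  fixes f :: "'a::{finite,field} poly poly"
  defines "q \<equiv> card (UNIV :: 'a set)"
  assumes f: "exact (Suc n) f" "prime_elem f" and nd: "\<not> f dvd frob q (Suc n) f" and q: "2 \<le> q"
  shows "2 * card (zs (Suc n) f) \<le> Suc n * (q + n)"
proof -
  let ?S = "zs (Suc n) f"
  have ff: "f \<in> form (Suc n)" using f(1) by blast
  have "\<exists>v. cross P v \<noteq> (0, 0, 0) \<and> dot (grad n f P) v = 0" if "P \<in> ?S" for P
  proof -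
    from that have P: "P \<in> pts" "ev (Suc n) f P = 0" by (auto simp: zs_def)
    then have "dot (grad n f P) P = 0" using dot_grad_self[OF ff, of P] by simp
    then obtain c where c: "c \<in> pts" "P \<in> line c" "\<And>Q. dot c Q = 0 \<Longrightarrow> dot (grad n f P) Q = 0"
      using tangent_line_exists[OF P(1)] by metis
    have "\<not> line c \<subseteq> {P}"
    proof
      assume "line c \<subseteq> {P}"
      then have "card (line c) \<le> 1" using card_mono[of "{P}" "line c"] by simp
      then show False using card_line[OF c(1)] q q_def by simp
    qed
    then obtain Q where Q: "Q \<in> line c" "Q \<noteq> P" by blast
    then have "cross P Q \<noteq> (0, 0, 0)" "dot (grad n f P) Q = 0"
      using cross_pts_eq[of P Q] P c(3)[of Q] by (auto simp: line_def)
    then show ?thesis by blast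
  qed
  then obtain v where v: "\<And>P. P \<in> ?S \<Longrightarrow> cross P (v P) \<noteq> (0, 0, 0)"
    "\<And>P. P \<in> ?S \<Longrightarrow> dot (grad n f P) (v P) = 0" by metis
  have c01: "coeff (lnp (Suc n) f P (v P)) 0 = 0" "coeff (lnp (Suc n) f P (v P)) 1 = 0" if "P \<in> ?S" for P
    using that v(2)[OF that] by (simp_all only: coeff_0_lnp coeff_1_lnp) (simp add: zs_def)
  show ?thesis
  proof (rule tangential_bezout[OF f frob_parts(1)[OF ff] nd zs_sub v(1)])
    fix P assume P: "P \<in> ?S"
    show "[:0, 1:] ^ 2 dvd lnp (Suc n) f P (v P)"
      unfolding X_power_dvd_iff using c01[OF P] by (auto simp: less_2_cases_iff)
    have key: "lnp (q + n) (frob q (Suc n) f) P (v P) = of_nat (Suc n) * lnp (Suc n) f P (v P) +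
       (monom 1 q - monom 1 1) * pderiv (lnp (Suc n) f P (v P))"
      using lnp_frob[OF ff, of P "v P"] unfolding q_def by (simp add: monom_altdef)
    have "coeff (lnp (q + n) (frob q (Suc n) f) P (v P)) i = 0" if "i < 2" for i
    proof -
      have "i = 0 \<or> i = 1" using that by auto
      moreover have "coeff ((monom 1 q - monom 1 1) * p) i = - (if i = 0 then 0 else coeff p (i - 1))" for p :: "'a poly"
        using that q by (simp add: left_diff_distrib coeff_monom_mult)
      moreover have "coeff (of_nat (Suc n) * p) i = of_nat (Suc n) * coeff p i" for p :: "'a poly"
        by (simp add: of_nat_poly del: of_nat_Suc)
      ultimately show ?thesis unfolding key coeff_add using c01[OF P]
        by (auto simp: coeff_pderiv)
    qed
    then show "[:0, 1:] ^ 2 dvd lnp (q + n) (frob q (Suc n) f) P (v P)"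
      unfolding X_power_dvd_iff by blast
  qed
qed

section \<open>Line arrangements\<close>

lemma meet_card:
  fixes c d :: "'a::{finite,field} vec3"
  assumes "c \<in> pts" "d \<in> pts" "c \<noteq> d"
  obtains P where "line c \<inter> line d = {P}"
proof -
  obtain P where P: "P \<in> pts" "dot P c = 0" "dot P d = 0"
    and u: "\<And>Q. Q \<in> pts \<Longrightarrow> dot Q c = 0 \<Longrightarrow> dot Q d = 0 \<Longrightarrow> Q = P"
    using join_ex1[OF assms] by metis
  have mem: "Q \<in> line x \<longleftrightarrow> Q \<in> pts \<and> dot Q x = 0" for Q x
    unfolding line_def mem_Collect_eq dot_commute[of x Q] ..
  have "line c \<inter> line d = {P}"
    unfolding set_eq_iff Int_iff singleton_iff mem using P u by blast
  then show ?thesis by (rule that)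
qed

lemma meet_eq:
  fixes c d :: "'a::{finite,field} vec3"
  assumes "c \<in> pts" "d \<in> pts" "c \<noteq> d" "P \<in> line c" "P \<in> line d"
  shows "line c \<inter> line d = {P}"
proof -
  obtain R where R: "line c \<inter> line d = {R}" using meet_card[OF assms(1-3)] .
  moreover have "P \<in> line c \<inter> line d" using assms by blast
  ultimately show ?thesis by simp
qed

text \<open>Each point other than \<open>O'\<close> lies on exactly one line through
  \<open>O'\<close>.\<close>

lemma star_card:
  fixes S :: "'a::{finite,field} vec3 set"
  assumes "S \<subseteq> pts" "O' \<in> pts"
  shows "card (S - {O'}) = (\<Sum>c\<in>{c \<in> pts. O' \<in> line c}. card (line c \<inter> S - {O'}))"
proof -
  have "S - {O'} = (\<Union>c\<in>{c \<in> pts. O' \<in> line c}. line c \<inter> S - {O'})"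
  proof (intro equalityI subsetI)
    fix P assume P: "P \<in> S - {O'}"
    then obtain c where "c \<in> pts" "dot c O' = 0" "dot c P = 0" using join_ex1[of O' P] assms by blast
    then have "c \<in> pts" "O' \<in> line c" "P \<in> line c" using P assms by (auto simp: line_def)
    then show "P \<in> (\<Union>c\<in>{c \<in> pts. O' \<in> line c}. line c \<inter> S - {O'})" using P by blast
  qed auto
  also have "card \<dots> = (\<Sum>c\<in>{c \<in> pts. O' \<in> line c}. card (line c \<inter> S - {O'}))"
  proof (rule card_UN_disjoint)
    show "\<forall>c\<in>{c \<in> pts. O' \<in> line c}. \<forall>d\<in>{c \<in> pts. O' \<in> line c}. c \<noteq> d \<longrightarrow>
        (line c \<inter> S - {O'}) \<inter> (line d \<inter> S - {O'}) = {}"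
    proof (intro ballI impI)
      fix c d assume *: "c \<in> {c \<in> pts. O' \<in> line c}" "d \<in> {c \<in> pts. O' \<in> line c}" "c \<noteq> d"
      then have "line c \<inter> line d = {O'}" using meet_eq by blast
      then show "(line c \<inter> S - {O'}) \<inter> (line d \<inter> S - {O'}) = {}" by blast
    qed
  qed auto
  finally show ?thesis .
qed

abbreviation cover :: "'a::field vec3 set \<Rightarrow> 'a vec3 set" where
  "cover C \<equiv> \<Union> (line ` C)"

lemma line_sub: "line c \<subseteq> pts"
  by (auto simp: line_def)

text \<open>Sweep by the lines through \<open>O'\<close>: the \<open>k\<close> of them in
  \<open>C\<close> add q points each; each of the other \<open>q + 1 - k\<close> meets the remaining
  \<open>card C - k\<close> lines once each and \<open>S\<close> at most \<open>e\<close> times. The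
  1 stands for \<open>O'\<close>.\<close>

lemma pencil_bound:
  fixes C S :: "'a::{finite,field} vec3 set"
  defines "q \<equiv> card (UNIV :: 'a set)"
  assumes O: "O' \<in> pts" and C: "C \<subseteq> pts" and S: "S \<subseteq> pts" "\<And>c. c \<in> pts \<Longrightarrow> card (line c \<inter> S) \<le> e"
  defines "k \<equiv> card {c \<in> C. O' \<in> line c}"
  shows "card (cover C \<union> S) \<le> 1 + k * q + (q + 1 - k) * (card C - k + e)"
proof -
  let ?T = "cover C \<union> S"
  let ?L = "{c \<in> pts. O' \<in> line c}"
  let ?K = "{c \<in> C. O' \<in> line c}"
  have KL: "?K \<subseteq> ?L" using C by auto
  have cL: "card ?L = q + 1" unfolding q_def by (rule card_lines_through[OF O])
  have T: "?T \<subseteq> pts" using S line_sub by blast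
  have "card ?T \<le> 1 + card (?T - {O'})"
    using card_Diff1_le[of ?T O'] by (cases "O' \<in> ?T") (simp_all add: card_Diff_singleton)
  also have "card (?T - {O'}) = (\<Sum>c\<in>?L. card (line c \<inter> ?T - {O'}))"
    by (rule star_card[OF T O])
  also have "\<dots> = (\<Sum>c\<in>?K. card (line c \<inter> ?T - {O'})) + (\<Sum>c\<in>?L - ?K. card (line c \<inter> ?T - {O'}))"
    using sum.subset_diff[OF KL, of "\<lambda>c. card (line c \<inter> ?T - {O'})"] by simp
  also have "(\<Sum>c\<in>?K. card (line c \<inter> ?T - {O'})) \<le> (\<Sum>c\<in>?K. q)"
  proof (rule sum_mono)
    fix c assume "c \<in> ?K"
    then have "card (line c - {O'}) = q" using card_line[of c] C by (auto simp: q_def card_Diff_singleton)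
    moreover have "card (line c \<inter> ?T - {O'}) \<le> card (line c - {O'})" by (rule card_mono) auto
    ultimately show "card (line c \<inter> ?T - {O'}) \<le> q" by simp
  qed
  also have "(\<Sum>c\<in>?K. q) = k * q" by (simp add: k_def)
  also have "(\<Sum>c\<in>?L - ?K. card (line c \<inter> ?T - {O'})) \<le> (\<Sum>c\<in>?L - ?K. card C - k + e)"
  proof (rule sum_mono)
    fix c assume c: "c \<in> ?L - ?K"
    have "line c \<inter> ?T - {O'} \<subseteq> (\<Union>d\<in>C - ?K. line c \<inter> line d) \<union> (line c \<inter> S)"
    proof
      fix P assume P: "P \<in> line c \<inter> ?T - {O'}"
      show "P \<in> (\<Union>d\<in>C - ?K. line c \<inter> line d) \<union> (line c \<inter> S)"
      proof (cases "P \<in> S")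
        case False
        then obtain d where d: "d \<in> C" "P \<in> line d" using P by auto
        have "O' \<notin> line d"
        proof
          assume "O' \<in> line d"
          then have "c \<noteq> d" using c d by auto
          then have "line c \<inter> line d = {O'}" using meet_eq[of c d O'] c d C \<open>O' \<in> line d\<close> by blast
          then show False using d P by blast
        qed
        then show ?thesis using P d by blast
      qed (use P in blast)
    qed
    then have "card (line c \<inter> ?T - {O'}) \<le> card ((\<Union>d\<in>C - ?K. line c \<inter> line d) \<union> (line c \<inter> S))"
      by (intro card_mono) auto
    also have "\<dots> \<le> card (\<Union>d\<in>C - ?K. line c \<inter> line d) + card (line c \<inter> S)" by (rule card_Un_le)
    also have "card (\<Union>d\<in>C - ?K. line c \<inter> line d) \<le> (\<Sum>d\<in>C - ?K. card (line c \<inter> line d))"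
      by (rule card_UN_le) simp
    also have "\<dots> \<le> (\<Sum>d\<in>C - ?K. 1)"
    proof (rule sum_mono)
      fix d assume d: "d \<in> C - ?K"
      then have "c \<noteq> d" using c by auto
      then obtain R where "line c \<inter> line d = {R}" using meet_card[of c d] c d C by blast
      then show "card (line c \<inter> line d) \<le> 1" by simp
    qed
    also have "\<dots> = card C - k" unfolding k_def by (simp add: card_Diff_subset)
    also have "card (line c \<inter> S) \<le> e" using S c by blast
    finally show "card (line c \<inter> ?T - {O'}) \<le> card C - k + e" by simp
  qed
  also have "\<dots> = (q + 1 - k) * (card C - k + e)"
    using cL card_Diff_subset[OF _ KL] by (simp add: k_def)
  finally show ?thesis by simp
qed

text \<open>Sweep by the lines through \<open>P\<close>. The count on \<open>d\<close> is kept
  instead of being bounded by \<open>e\<close>, because it cancels in the size of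
  \<open>line d \<union> S\<close>.\<close>

lemma arc_bound:
  fixes S :: "'a::{finite,field} vec3 set"
  defines "q \<equiv> card (UNIV :: 'a set)"
  assumes S: "S \<subseteq> pts" "\<And>c. c \<in> pts \<Longrightarrow> card (line c \<inter> S) \<le> e" and d: "d \<in> pts" "P \<in> line d \<inter> S"
  shows "card S \<le> card (line d \<inter> S) + q * (e - 1)"
proof -
  let ?L = "{c \<in> pts. P \<in> line c}"
  have P: "P \<in> pts" using S d by auto
  have cL: "card ?L = q + 1" unfolding q_def by (rule card_lines_through[OF P])
  have one: "card (line c \<inter> S - {P}) = card (line c \<inter> S) - 1" if "c \<in> ?L" for c
    using that d by (simp add: card_Diff_singleton)
  have "card S = 1 + card (S - {P})"
    using card_Suc_Diff1[of S P] d by simp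
  also have "card (S - {P}) = (\<Sum>c\<in>?L. card (line c \<inter> S - {P}))" by (rule star_card[OF S(1) P])
  also have "\<dots> = card (line d \<inter> S - {P}) + (\<Sum>c\<in>?L - {d}. card (line c \<inter> S - {P}))"
    by (rule sum.remove) (use d in auto)
  also have "(\<Sum>c\<in>?L - {d}. card (line c \<inter> S - {P})) \<le> (\<Sum>c\<in>?L - {d}. e - 1)"
    by (intro sum_mono) (use one S in \<open>auto intro!: diff_le_mono\<close>)
  also have "\<dots> = q * (e - 1)" using cL d by (simp add: card_Diff_singleton)
  also have "1 + (card (line d \<inter> S - {P}) + q * (e - 1)) = card (line d \<inter> S) + q * (e - 1)"
    using card_Suc_Diff1[of "line d \<inter> S" P] d by simp
  finally show ?thesis by simp
qed

lemma arc_bound':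
  fixes S :: "'a::{finite,field} vec3 set"
  defines "q \<equiv> card (UNIV :: 'a set)"
  assumes S: "S \<subseteq> pts" "\<And>c. c \<in> pts \<Longrightarrow> card (line c \<inter> S) \<le> Suc n"
  shows "card S \<le> n * (q + 1) + 1"
proof (cases "S = {}")
  case False
  then obtain P where P: "P \<in> S" by blast
  have "card {c \<in> pts. P \<in> line c} = q + 1" unfolding q_def using card_lines_through S P by blast
  then have "{c \<in> pts. P \<in> line c} \<noteq> {}" by (intro notI) simp
  then obtain d where "d \<in> pts" "P \<in> line d" by blast
  then have "card S \<le> card (line d \<inter> S) + q * (Suc n - 1)" unfolding q_def
    using arc_bound[OF S] P by blast
  then show ?thesis using S(2)[OF \<open>d \<in> pts\<close>] by (simp add: algebra_simps)
qed simp

lemma card_cover_minus_line: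
  fixes C :: "'a::{finite,field} vec3 set"
  defines "q \<equiv> card (UNIV :: 'a set)"
  assumes "C \<subseteq> pts" "d \<in> pts"
  shows "card (cover C - line d) \<le> card (C - {d}) * q"
proof -
  have "cover C - line d = (\<Union>c\<in>C - {d}. line c - line d)" by auto
  also have "card \<dots> \<le> (\<Sum>c\<in>C - {d}. card (line c - line d))" by (rule card_UN_le) simp
  also have "\<dots> \<le> (\<Sum>c\<in>C - {d}. q)"
  proof (rule sum_mono)
    fix c assume c: "c \<in> C - {d}"
    then obtain P where P: "line c \<inter> line d = {P}" using meet_card[of c d] assms by blast
    have "line c - line d = line c - {P}" using P by blast
    moreover have "P \<in> line c" using P by blast
    ultimately show "card (line c - line d) \<le> q"
      using card_line[of c] c assms by (auto simp: card_Diff_singleton)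
  qed
  finally show ?thesis by simp
qed

lemma card_cover_le:
  fixes C :: "'a::{finite,field} vec3 set"
  assumes "C \<subseteq> pts"
  shows "card (cover C) \<le> card C * card (UNIV :: 'a set) + 1"
proof (cases "C = {}")
  case False
  then obtain d where d: "d \<in> C" by blast
  then have dp: "d \<in> pts" using assms by blast
  have "card (cover C) \<le> card ((cover C - line d) \<union> line d)" by (rule card_mono) auto
  also have "\<dots> \<le> card (cover C - line d) + card (line d)" by (rule card_Un_le)
  also have "\<dots> \<le> card (C - {d}) * card (UNIV :: 'a set) + (card (UNIV :: 'a set) + 1)"
    using card_cover_minus_line[OF assms dp] card_line[OF dp] by simp
  also have "\<dots> = Suc (card (C - {d})) * card (UNIV :: 'a set) + 1" by simp
  also have "Suc (card (C - {d})) = card C" by (rule card_Suc_Diff1) (use d in auto)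
  finally show ?thesis .
qed simp

lemma pencil_card:
  fixes K :: "'a::{finite,field} vec3 set"
  assumes "K \<subseteq> pts" "K \<noteq> {}" "\<And>c. c \<in> K \<Longrightarrow> O' \<in> line c"
  shows "card (cover K) = card K * card (UNIV :: 'a set) + 1"
  using finite_vec3[of K] assms
proof (induction K rule: finite_induct)
  case (insert c K)
  show ?case
  proof (cases "K = {}")
    case True
    then show ?thesis using card_line[of c] insert.prems by simp
  next
    case False
    have "line c - cover K = line c - {O'}"
    proof
      show "line c - {O'} \<subseteq> line c - cover K"
      proof
        fix P assume P: "P \<in> line c - {O'}"
        have "P \<notin> line d" if "d \<in> K" for d
        proof -
          have "c \<noteq> d" using that insert.hyps by auto
          then have "line c \<inter> line d = {O'}"
            using meet_eq[of c d O'] insert.prems(1) insert.prems(3)[of c] insert.prems(3)[of d] that by blast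
          then show ?thesis using P by blast
        qed
        then show "P \<in> line c - cover K" using P by blast
      qed
      obtain d where d: "d \<in> K" using False by blast
      then have "O' \<in> cover K" using insert.prems(3)[of d] by blast
      then show "line c - cover K \<subseteq> line c - {O'}" by blast
    qed
    moreover have "card (line c - {O'}) = card (UNIV :: 'a set)"
      using card_line[of c] insert.prems by (simp add: card_Diff_singleton)
    moreover have "cover (insert c K) = cover K \<union> (line c - cover K)" by auto
    moreover have "card (cover K \<union> (line c - cover K)) = card (cover K) + card (line c - cover K)"
      by (rule card_Un_disjoint) auto
    ultimately show ?thesis using insert False by simp
  qed
qed simp_all

text \<open>Each new line meets the earlier ones in distinct points, as no three lines concur.
  Doubling replaces the division in k (q + 1) - k (k - 1) / 2.\<close>

lemma general_position_card:
  fixes C :: "'a::{finite,field} vec3 set"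
  assumes "C \<subseteq> pts" "\<And>P. P \<in> pts \<Longrightarrow> card {c \<in> C. P \<in> line c} \<le> 2"
  shows "2 * card (cover C) + card C * (card C - 1) \<le> 2 * card C * (card (UNIV :: 'a set) + 1)"
  using finite_vec3[of C] assms
proof (induction C rule: finite_induct)
  case (insert c C)
  let ?q = "card (UNIV :: 'a set)"
  have IH: "2 * card (cover C) + card C * (card C - 1) \<le> 2 * card C * (?q + 1)"
  proof (rule insert.IH)
    fix P :: "'a vec3" assume "P \<in> pts"
    moreover have "card {d \<in> C. P \<in> line d} \<le> card {d \<in> insert c C. P \<in> line d}" by (rule card_mono) auto
    ultimately show "card {d \<in> C. P \<in> line d} \<le> 2" using insert.prems(2) order_trans by blast
  qed (use insert.prems in auto)
  have "\<exists>P. line c \<inter> line d = {P}" if "d \<in> C" for d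
  proof -
    have "c \<in> pts" "d \<in> pts" "c \<noteq> d" using insert.prems(1) insert.hyps(2) that by auto
    then obtain P where "line c \<inter> line d = {P}" by (rule meet_card)
    then show ?thesis ..
  qed
  then obtain p where p: "\<And>d. d \<in> C \<Longrightarrow> line c \<inter> line d = {p d}" by metis
  have pm: "p d \<in> line c" "p d \<in> line d" if "d \<in> C" for d
  proof -
    have "p d \<in> line c \<inter> line d" unfolding p[OF that] by simp
    then show "p d \<in> line c" "p d \<in> line d" by simp_all
  qed
  have "inj_on p C"
  proof (rule inj_onI, rule ccontr)
    fix d d' assume *: "d \<in> C" "d' \<in> C" "p d = p d'" "d \<noteq> d'"
    have "p d \<in> line c" "p d \<in> line d" "p d \<in> line d'" using pm *(1-3) by metis+
    then have "{c, d, d'} \<subseteq> {x \<in> insert c C. p d \<in> line x}" using *(1,2) by simp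
    then have "card {c, d, d'} \<le> card {x \<in> insert c C. p d \<in> line x}" by (intro card_mono) simp_all
    also have "\<dots> \<le> 2" using subsetD[OF line_sub pm(1)[OF *(1)]] by (rule insert.prems(2))
    finally have "card {c, d, d'} \<le> 2" .
    moreover have "c \<noteq> d" "c \<noteq> d'" using *(1,2) insert.hyps by metis+
    ultimately show False using *(4) by simp
  qed
  then have "card C = card (p ` C)" by (rule card_image[symmetric])
  also have "p ` C \<subseteq> line c \<inter> cover C"
    using pm by (intro image_subsetI IntI UN_I) simp_all
  then have "card (p ` C) \<le> card (line c \<inter> cover C)" by (intro card_mono) simp_all
  finally have 1: "card C \<le> card (line c \<inter> cover C)" .
  have "card (cover (insert c C)) + card (line c \<inter> cover C) = card (line c) + card (cover C)"
    using card_Un_Int[of "line c" "cover C"] by simp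
  then have 2: "card (cover (insert c C)) + card C \<le> (?q + 1) + card (cover C)"
    using 1 card_line[of c] insert.prems(1) by simp
  have 3: "card (insert c C) = Suc (card C)" using insert.hyps by simp
  have 4: "Suc (card C) * (Suc (card C) - 1) = card C * (card C - 1) + 2 * card C"
    by (cases "card C") simp_all
  have 5: "2 * Suc (card C) * (?q + 1) = 2 * card C * (?q + 1) + 2 * (?q + 1)" by simp
  have "2 * b + (B + 2 * k) \<le> A + 2 * w" if "2 * a + B \<le> A" "b + k \<le> w + a" for a b A B k w :: nat
    using that by linarith
  from this[OF IH 2] show ?case unfolding 3 4 5 .
qed simp_all

section \<open>Curves without linear components\<close>

lemma zs_lform: "zs (Suc 0) (lform c) = line c"
  by (auto simp: zs_def line_def ev_lform simp del: ev.simps lform.simps)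

section \<open>Splitting off linear factors\<close>

lemma hev_affine:
  assumes "f \<in> form n"
  shows "hev n f X Y 1 = (\<Sum>j\<le>n. pcompose (coeff f j) X * Y ^ j)"
proof -
  have tri: "tri n = (\<lambda>(j, i). (i, j)) ` (SIGMA j:{..n}. {..n - j})"
    by (auto simp: tri_def image_iff)
  have "hev n f X Y 1 = (\<Sum>(j, i)\<in>(SIGMA j:{..n}. {..n - j}). smult (cf f i j) (X ^ i * Y ^ j))"
    unfolding hev_def tri by (subst sum.reindex) (auto simp: inj_on_def intro!: sum.cong)
  also have "\<dots> = (\<Sum>j\<le>n. \<Sum>i\<le>n - j. smult (cf f i j) (X ^ i * Y ^ j))"
    by (subst sum.Sigma) auto
  also have "\<dots> = (\<Sum>j\<le>n. pcompose (coeff f j) X * Y ^ j)"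
  proof (rule sum.cong[OF refl])
    fix j assume "j \<in> {..n}"
    have "degree (coeff f j) \<le> n - j"
      by (rule degree_le) (use formD[OF assms] in auto)
    then have "coeff f j = (\<Sum>i\<le>n - j. smult (cf f i j) ([:0, 1:] ^ i))"
      using poly_as_sum_of_monoms'[of "coeff f j" "n - j"] by (simp add: monom_altdef)
    then have "pcompose (coeff f j) X = pcompose (\<Sum>i\<le>n - j. smult (cf f i j) ([:0, 1:] ^ i)) X" by simp
    also have "\<dots> = (\<Sum>i\<le>n - j. smult (cf f i j) (X ^ i))"
      by (simp add: pcompose_sum pcompose_smult pcompose_power pcompose_pCons)
    finally have "pcompose (coeff f j) X = (\<Sum>i\<le>n - j. smult (cf f i j) (X ^ i))" .
    then show "(\<Sum>i\<le>n - j. smult (cf f i j) (X ^ i * Y ^ j)) = pcompose (coeff f j) X * Y ^ j"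
      by (simp add: sum_distrib_right)
  qed
  finally show ?thesis .
qed

text \<open>Degree \<open>n = q\<close> is still allowed: besides the q zeros at finite parameters,
  the zero at \<open>w\<close> kills the coefficient of degree \<open>n\<close>, so the remaining
  degree is below q.\<close>

lemma lnp_eq_0_on_line:
  fixes f :: "'a::{finite,field} poly poly"
  assumes n: "0 < n" "n \<le> card (UNIV :: 'a set)" and c: "c \<in> pts" "line c \<subseteq> zs n f"
    and uw: "dot c u = 0" "dot c w = 0"
  shows "lnp n f u w = 0"
proof -
  have z: "ev n f x = 0" if "dot c x = 0" for x
  proof (cases "x = (0, 0, 0)")
    case True
    have "ev n f (0, 0, 0) = 0 ^ n * ev n f (0, 0, 0)"
      using ev_scale[of n f 0 0 0 0] by (simp del: ev.simps)
    then show ?thesis using n by (simp add: True zero_power del: ev.simps)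
  next
    case False
    then obtain s p where p: "s \<noteq> 0" "p \<in> pts" "x = scale s p" by (rule normalize)
    then have "p \<in> line c" using that by (simp add: line_def dot_scale)
    then have "ev n f p = 0" using c(2) unfolding zs_def by blast
    then show ?thesis using ev_scale[of n f s] unfolding p(3) by (cases p) (simp del: ev.simps)
  qed
  have dc: "dot c (comb 1 u t w) = 0" for t
  proof -
    have "dot c (comb 1 u t w) = dot c u + t * dot c w"
      by (cases c; cases u; cases w) (simp add: algebra_simps)
    then show ?thesis using uw by simp
  qed
  have "coeff (lnp n f u w) n = 0"
    using coeff_lnp_swap[of 0 n f w u] z[OF uw(2)] by (simp add: coeff_0_lnp)
  then have "degree (lnp n f u w) < n \<or> lnp n f u w = 0"
    using degree_lnp[of n f u w] by (metis leading_coeff_0_iff le_neq_implies_less)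
  then show ?thesis
    using poly_eq_0_if_many_roots[of "lnp n f u w"] n z[OF dc] by (auto simp: poly_lnp)
qed

text \<open>There are three types of lines: y = p(x), giving a root of the outer polynomial; x = r,
  giving a common root of all its coefficients; and z = 0, where only the degree drops.\<close>

lemma lform_dvd:
  fixes f :: "'a::{finite,field} poly poly"
  assumes f: "f \<in> form (Suc n)" and n: "Suc n \<le> card (UNIV :: 'a set)"
    and c: "c \<in> pts" "line c \<subseteq> zs (Suc n) f"
  obtains g where "g \<in> form n" "f = lform c * g"
proof -
  note result = that
  obtain a b e where abe: "c = (a, b, e)" by (metis prod.exhaust)
  note z = lnp_eq_0_on_line[OF _ n c, simplified]
  have dvd: thesis if "lform c dvd f" "a \<noteq> 0 \<or> b \<noteq> 0"
  proof -
    from that(1) obtain g where g: "f = lform c * g" by blast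
    have "hev 1 (lform c) [:0, 1:] 1 0 = [:b, a:]"
      by (simp add: abe hev_def tri_1)
    then have "exact 1 (lform c)" using form_lform[of c] that(2) by (auto simp: exact_def)
    then have "g \<in> form n" using form_cancel(2)[of 1 "lform c" g "Suc n"] f g by (cases "g = 0") simp_all
    then show thesis using g by (rule result)
  qed
  show thesis
  proof (cases "b = 0")
    case False
    define p where "p = [:- e / b, - a / b:]"
    have "lnp (Suc n) f (0, - e / b, 1) (1, - a / b, 0) = 0"
      by (rule z) (use False in \<open>simp_all add: abe\<close>)
    then have "hev (Suc n) f [:0, 1:] p 1 = 0" by (simp add: p_def)
    then have "(\<Sum>j\<le>Suc n. coeff f j * p ^ j) = 0"
      using hev_affine[OF f, of "[:0, 1:]" p] by (simp only: pcompose_idR)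
    moreover have "degree f \<le> Suc n"
      by (rule degree_le) (use formD[OF f] in \<open>auto intro!: poly_eqI\<close>)
    then have "poly f p = (\<Sum>j\<le>Suc n. coeff f j * p ^ j)"
      unfolding poly_altdef by (intro sum.mono_neutral_left) (auto simp: coeff_eq_0)
    ultimately have "[:- p, 1:] dvd f" by (simp add: poly_eq_0_iff_dvd)
    moreover have "lform c = [:[:b:]:] * [:- p, 1:]" using False by (simp add: abe p_def)
    moreover have "[:[:b:]:] dvd (1 :: 'a poly poly)"
      using False by (simp only: is_unit_const_poly_iff dvd_field_iff) simp
    ultimately have "lform c dvd f" by (simp only: mult_unit_dvd_iff')
    then show thesis using dvd False by blast
  next
    case b: True
    show thesis
    proof (cases "a = 0")
      case False
      define r where "r = - e / a"
      have "lnp (Suc n) f (r, 0, 1) (0, 1, 0) = 0"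
        by (rule z) (use False b in \<open>simp_all add: abe r_def\<close>)
      then have "hev (Suc n) f [:r:] [:0, 1:] 1 = 0" by simp
      then have s: "(\<Sum>j\<le>Suc n. [:poly (coeff f j) r:] * [:0, 1:] ^ j) = 0"
        using hev_affine[OF f, of "[:r:]" "[:0, 1:]"] by (simp add: pcompose_pCons_0)
      have "poly (coeff f k) r = 0" for k
      proof (cases "k \<le> Suc n")
        case True
        have "0 = coeff (\<Sum>j\<le>Suc n. [:poly (coeff f j) r:] * [:0, 1:] ^ j) k" unfolding s by simp
        also have "\<dots> = (\<Sum>j\<le>Suc n. if j = k then poly (coeff f k) r else 0)"
          unfolding coeff_sum
        proof (rule sum.cong[OF refl])
          fix j
          have "[:0, 1::'a:] ^ j = monom 1 j" by (simp add: monom_altdef)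
          then show "coeff ([:poly (coeff f j) r:] * [:0, 1:] ^ j) k = (if j = k then poly (coeff f k) r else 0)"
            by simp
        qed
        finally show ?thesis using True by (simp del: sum.atMost_Suc)
      next
        case False
        have "coeff f k = 0" by (intro poly_eqI) (use formD[OF f] False in auto)
        then show ?thesis by simp
      qed
      then have "[:- r, 1:] dvd coeff f k" for k by (simp only: poly_eq_0_iff_dvd)
      then have "smult a [:- r, 1:] dvd coeff f k" for k using False by (simp only: smult_dvd_iff if_False)
      moreover have "[:e, a:] = smult a [:- r, 1:]" using False by (simp add: r_def)
      ultimately have "[:e, a:] dvd coeff f k" for k by (simp only:)
      then have "[:[:e, a:]:] dvd f" by (simp add: const_poly_dvd_iff)
      then have "lform c dvd f" by (simp add: abe b)
      then show thesis using dvd False by blast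
    next
      case True
      then have c1: "c = (0, 0, 1)" using b c(1) abe by (auto simp: pts_def)
      have "lnp (Suc n) f (0, 1, 0) (1, 0, 0) = 0" by (rule z) (simp_all add: c1)
      then have "hev (Suc n) f [:0, 1:] 1 0 = 0" by simp
      then have "f \<in> form n" using form_lower[OF f] by blast
      \<comment> \<open>\<open>lform (0, 0, 1)\<close> is the constant 1, so the cofactor is
        \<open>f\<close> itself, taken in degree \<open>n\<close>.\<close>
      then show thesis by (rule result) (simp add: c1)
    qed
  qed
qed

text \<open>The lines form a list because a component may be repeated: the length counts
  multiplicities for the degree, while \<open>cover\<close> forgets them.\<close>

lemma split_off_lines:
  fixes f :: "'a::{finite,field} poly poly"
  assumes "f \<in> form n" "f \<noteq> 0" "n \<le> card (UNIV :: 'a set)"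
  obtains cs g e where "set cs \<subseteq> pts" "length cs + e = n" "g \<in> form e" "lineless e g"
    "zs n f = cover (set cs) \<union> zs e g"
proof -
  have "\<exists>cs g e. set cs \<subseteq> pts \<and> length cs + e = n \<and> g \<in> form e \<and> lineless e g \<and>
    zs n f = cover (set cs) \<union> zs e g"
    using assms
  proof (induction n arbitrary: f)
    case 0
    have "cf f 0 0 \<noteq> 0"
    proof
      assume "cf f 0 0 = 0"
      then have "cf f i j = 0" for i j using formD[OF 0(1), of i j] by (cases "i + j = 0") auto
      then have "f = 0" by (intro poly_eqI) simp
      with 0 show False by simp
    qed
    then have "ev 0 f P \<noteq> 0" for P by (cases P) (simp add: ev_def' tri_def del: ev.simps)
    then have "zs 0 f = {}" unfolding zs_def by blast
    moreover have "line c \<noteq> {}" if "c \<in> pts" for c :: "'a vec3"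
      using card_line[OF that] by (intro notI) simp
    ultimately have "lineless 0 f" by (simp add: lineless_def)
    then show ?case using 0(1) by (intro exI[of _ "[]"] exI[of _ f] exI[of _ 0]) simp
  next
    case (Suc n)
    show ?case
    proof (cases "lineless (Suc n) f")
      case True
      then show ?thesis using Suc.prems(1) by (intro exI[of _ "[]"] exI[of _ f] exI[of _ "Suc n"]) simp
    next
      case False
      then obtain c where c: "c \<in> pts" "line c \<subseteq> zs (Suc n) f" unfolding lineless_def by blast
      obtain h where h: "h \<in> form n" "f = lform c * h"
        using lform_dvd[OF Suc.prems(1,3) c] .
      then have "h \<noteq> 0" using Suc.prems(2) by auto
      then obtain cs g e where IH: "set cs \<subseteq> pts" "length cs + e = n" "g \<in> form e" "lineless e g"
        "zs n h = cover (set cs) \<union> zs e g" using Suc.IH[OF h(1)] Suc.prems(3) by (meson Suc_leD)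
      have "zs (1 + n) (lform c * h) = zs 1 (lform c) \<union> zs n h"
        by (rule zs_mult[OF form_lform h(1)])
      then have "zs (Suc n) f = cover (set (c # cs)) \<union> zs e g"
        using IH(5) by (simp add: h(2) zs_lform Un_assoc)
      then show ?thesis using IH c(1)
        by (intro exI[of _ "c # cs"] exI[of _ g] exI[of _ e]) simp
    qed
  qed
  then show ?thesis using that by blast
qed

text \<open>A form that is not exact in its degree is divisible by z and vanishes on the line z =
  0.\<close>

lemma exact_if_lineless:
  fixes f :: "'a::{finite,field} poly poly"
  assumes "f \<in> form n" "lineless n f"
  shows "exact n f"
proof (rule ccontr)
  assume "\<not> exact n f"
  then have 0: "lnp n f (0, 1, 0) (1, 0, 0) = 0" using assms(1) by (simp add: exact_def)
  have "ev n f (x, 1, 0) = 0" for x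
    using poly_lnp[of n f "(0, 1, 0)" "(1, 0, 0)" x] unfolding 0 by (simp del: ev.simps)
  moreover have "ev n f (1, 0, 0) = 0"
    using coeff_lnp_swap[of 0 n f "(1, 0, 0)" "(0, 1, 0)"] unfolding 0 coeff_0_lnp by simp
  ultimately have "line (0, 0, 1) \<subseteq> zs n f"
    by (auto simp: line_def zs_def pts_def simp del: ev.simps)
  then show False using assms(2) by (auto simp: lineless_def)
qed

lemma lineless_bound:
  fixes f :: "'a::{finite,field} poly poly"
  defines "q \<equiv> card (UNIV :: 'a set)"
  assumes "lineless (Suc n) f"
  shows "card (zs (Suc n) f) \<le> n * (q + 1) + 1"
  unfolding q_def using arc_bound'[OF zs_sub lineless_line_bound[OF assms(2)]] by blast

lemma lineless_factor:
  assumes "f \<in> form m" "g \<in> form n" "lineless (m + n) (f * g)"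
  shows "lineless m f" "lineless n g"
  using assms(3) unfolding lineless_def zs_mult[OF assms(1,2)] by blast+

text \<open>\<open>small\<close> covers reducible forms and, for \<open>e < q\<close>, irreducible
  ones that do not divide their Frobenius polar; \<open>full\<close> is the latter kind for
  \<open>e = q\<close>, and \<open>flex\<close> holds for those that divide it. \<open>M\<close>
  stays open there, since the lines missing the curve are known only where the lemma is
  applied.\<close>

lemma lineless_cases:
  fixes f :: "'a::{finite,field} poly poly"
  defines "q \<equiv> card (UNIV :: 'a set)"
  assumes f: "f \<in> form e" "lineless e f" and e: "2 \<le> e" "e \<le> q" "3 \<le> q"
  obtains (small) "card (zs e f) \<le> (e - 1) * q + 1"
    | (full) "e = q" "card (zs e f) \<le> (q - 1) * q + 2"
    | (flex) "\<And>M. M \<subseteq> pts \<Longrightarrow> (\<And>c. c \<in> M \<Longrightarrow> line c \<inter> zs e f = {}) \<Longrightarrow>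
        (q + 3) * card (zs e f) \<le> e * (q\<^sup>2 + q + 1 - card M)"
proof -
  have ex: "exact e f" using exact_if_lineless f by blast
  obtain n where n: "e = Suc n" using e(1) by (cases e) auto
  have nu: "\<not> f dvd 1"
  proof
    assume "f dvd 1"
    then obtain g where "1 = f * g" by blast
    moreover have "exact 0 (1 :: 'a poly poly)" by (simp add: exact_def form_1 hev_def tri_def)
    ultimately have "e \<le> 0" using exact_cancel(1)[OF ex, of 0 g] by simp
    then show False using e by simp
  qed
  show thesis
  proof (cases "irreducible f")
    case False
    then obtain a b where ab: "f = a * b" "\<not> a dvd 1" "\<not> b dvd 1"
      using nu exact_nonzero[OF ex] by (auto simp: irreducible_def)
    then have "a \<noteq> 0" using exact_nonzero[OF ex] by auto
    then obtain i where i: "exact i a" using exact_exists by blast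
    define j where "j = e - i"
    have j: "exact j b" "e = i + j" using exact_cancel[OF i, of e b] ex ab(1) by (auto simp: j_def)
    have "i \<noteq> 0" "j \<noteq> 0" using exact_0_unit i j ab by metis+
    then obtain i' j' where ij: "i = Suc i'" "j = Suc j'" by (metis not0_implies_Suc)
    have af: "a \<in> form i" "b \<in> form j" using i j by auto
    have ll: "lineless i a" "lineless j b"
      using lineless_factor[OF af] f(2) unfolding j(2) ab(1) by blast+
    have "card (zs e f) \<le> card (zs i a) + card (zs j b)"
      unfolding j(2) ab(1) zs_mult[OF af] by (rule card_Un_le)
    also have "\<dots> \<le> (i' * (q + 1) + 1) + (j' * (q + 1) + 1)"
      using ll lineless_bound[of i' a] lineless_bound[of j' b] unfolding ij q_def by (intro add_mono) auto
    also have "\<dots> = (i' + j') * q + (i' + j' + 2)" by (simp add: algebra_simps)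
    \<comment> \<open>The excess \<open>i' + j' + 2\<close> equals \<open>e\<close>, hence is at
      most \<open>q\<close>.\<close>
    also have "\<dots> \<le> (i' + j') * q + (q + 1)" using e j(2) ij by (intro add_left_mono) simp
    also have "\<dots> = (e - 1) * q + 1" by (simp add: j(2) ij algebra_simps)
    finally show thesis by (rule small)
  next
    case True
    then have pr: "prime_elem f" by simp
    show thesis
    proof (cases "f dvd frob q (Suc n) f")
      case False
      have "2 * card (zs e f) \<le> e * (q + n)"
        using frobenius_classical_bound[of n f] ex pr False e unfolding q_def n by simp
      show thesis
      proof (cases "e = q")
        case True
        \<comment> \<open>For \<open>e = q\<close>, Bezout gives only q^2 - q/2. Here
          \<open>(q + 2) * ((q - 1) * q + 3)\<close> exceeds \<open>q * (q\<^sup>2 + q + 1)\<close>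
          by exactly 6.\<close>
        have "(q + 2) * card (zs e f) \<le> e * (q\<^sup>2 + q + 1)"
          using tangent_count_2[of f n] f unfolding q_def n by simp
        also have "\<dots> < (q + 2) * ((q - 1) * q + 3)"
        proof -
          obtain r where "q = Suc r" using e by (cases q) auto
          then show ?thesis by (simp add: True power2_eq_square algebra_simps)
        qed
        finally have "card (zs e f) < (q - 1) * q + 3" using mult_less_cancel1 by blast
        then show thesis using full True by simp
      next
        case False
        obtain s where s: "q = e + 1 + s" using False e by (metis Suc_eq_plus1 Suc_leI le_Suc_ex le_neq_implies_less)
        obtain r where r: "e = r + 2" using e by (metis add.commute le_Suc_ex)
        have qr: "q = r + 3 + s" and nr: "n = r + 1" using s r n by simp_all
        have "2 * card (zs e f) \<le> (r + 2) * (r + 3 + s + (r + 1))"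
          using \<open>2 * card (zs e f) \<le> e * (q + n)\<close> by (simp only: qr nr r)
        \<comment> \<open>The two sides differ by \<open>r * s\<close>; equality occurs for
          \<open>e = 2\<close> and for \<open>e = q - 1\<close>.\<close>
        also have "\<dots> \<le> 2 * ((r + 1) * (r + 3 + s) + 1)" by (simp add: algebra_simps)
        also have "\<dots> = 2 * ((e - 1) * q + 1)" by (simp add: qr r)
        finally show thesis using small by simp
      qed
    next
      case True
      then obtain A where A: "frob q (Suc n) f = f * A" by blast
      have "frob q (Suc n) f \<in> form (q + n)" using frob_parts(1) f(1) n by blast
      then have "A \<in> form (q + n - Suc n)"
        using form_cancel(2)[of "Suc n" f A "q + n"] ex n A by (cases "A = 0") auto
      then have Af: "A \<in> form (q - 1)" by simp
      have "(q + 3) * card (zs e f) \<le> e * (q\<^sup>2 + q + 1 - card M)"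
        if "M \<subseteq> pts" "\<And>c. c \<in> M \<Longrightarrow> line c \<inter> zs e f = {}" for M
      proof -
        have "(q + 1 + 2) * card (zs (Suc n) f) \<le> Suc n * (q\<^sup>2 + q + 1 - card M)"
        proof (intro tangent_count[where f = f, folded q_def], goal_cases)
          case (5 P v)
          have "ev (Suc n) f P = 0" using 5(1) by (simp add: zs_def)
          then have "[:0, 1:] ^ 3 dvd lnp (Suc n) f P v"
            using frobenius_nonclassical_flex[of f n A P v, folded q_def] f(1) n Af A e 5(2,3) by blast
          then show ?case by (simp add: numeral_3_eq_3 numeral_2_eq_2)
        qed (use f n e that in auto)
        then show ?thesis by (simp add: n eval_nat_numeral)
      qed
      then show thesis by (rule flex)
    qed
  qed
qed

section \<open>The upper bound\<close>

text \<open>Since q^2 + q + 1 = (q + 3) (q - 2) + 7, the excess r of \<open>s\<close> over e (q - 2)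
  satisfies (q + 3) r \<le> e (7 - k), so r > 0 implies r < 7 - k. If both claimed bounds failed, r
  would also be bounded below by a quadratic in k; finitely many pairs (k, r) remain, each refuted
  by linear inequalities in e and q.\<close>

lemma flex_arithmetic:
  fixes q e k s u :: nat
  assumes e: "2 \<le> e" "e + k \<le> q" and s: "(q + 3) * s \<le> e * (q\<^sup>2 + q + 1 - k)"
    and u: "2 * u + k * (k - 1) \<le> 2 * k * (q + 1)" and d: "5 \<le> e + k"
  shows "s + u \<le> (e + k) * q + 1 - 2 * (e + k - 3) \<or> s + u \<le> (e + k - 1) * q + 2"
proof (rule ccontr)
  assume "\<not> ?thesis"
  then have lt: "(e + k) * q + 1 - 2 * (e + k - 3) < s + u" "(e + k - 1) * q + 2 < s + u" by auto
  define Q E K S U where int: "Q = int q" "E = int e" "K = int k" "S = int s" "U = int u"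
  define r where "r = S - E * (Q - 2)"
  have kq: "k \<le> q\<^sup>2 + q + 1" using e(2) by linarith
  have "int ((q + 3) * s) \<le> int (e * (q\<^sup>2 + q + 1 - k))" using s by linarith
  moreover have "int (q\<^sup>2 + q + 1 - k) = Q\<^sup>2 + Q + 1 - K" using kq by (simp add: int of_nat_diff)
  ultimately have "(Q + 3) * S \<le> E * (Q\<^sup>2 + Q + 1 - K)" by (simp only: of_nat_mult of_nat_add int of_nat_numeral)
  then have r: "(Q + 3) * r \<le> E * (7 - K)"
    unfolding r_def by (simp add: algebra_simps power2_eq_square)
  have k2: "int (k * (k - 1)) = K * K - K" by (cases k) (simp_all add: int algebra_simps)
  have "int (2 * u + k * (k - 1)) \<le> int (2 * k * (q + 1))" using u by linarith
  then have u': "2 * U + (K * K - K) \<le> 2 * K * (Q + 1)" unfolding of_nat_add k2 by (simp add: int algebra_simps)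
  have b: "2 \<le> E" "E + K \<le> Q" "5 \<le> E + K" "0 \<le> K" using e d by (simp_all add: int)
  have "(e + k) * q + 1 \<le> s + u + 2 * (e + k - 3) - 1" using lt(1) by linarith
  then have "int ((e + k) * q + 2) \<le> int (s + u + 2 * (e + k - 3))" using lt(1) by linarith
  then have "(E + K) * Q + 2 \<le> S + U + 2 * (E + K - 3)"
    using d by (simp add: int of_nat_diff)
  then have lt1: "2 * K * Q + 16 - 4 * K \<le> 2 * r + 2 * U"
    unfolding r_def by (simp add: algebra_simps)
  then have r1: "16 - 7 * K + K * K \<le> 2 * r" using u' by (simp add: algebra_simps)
  have "int ((e + k - 1) * q + 3) \<le> int (s + u)" using lt(2) by linarith
  then have "(E + K - 1) * Q + 3 \<le> S + U" using d by (simp add: int of_nat_diff)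
  then have r2: "4 * E + 6 + K * K - 3 * K \<le> 2 * r + 2 * Q" using u' unfolding r_def by (simp add: algebra_simps)
  \<comment> \<open>The discriminant 49 - 64 is negative.\<close>
  have "0 < 16 - 7 * K + K * K"
  proof -
    have "4 * (16 - 7 * K + K * K) = (2 * K - 7)\<^sup>2 + 15" by (simp add: power2_eq_square algebra_simps)
    also have "0 < (2 * K - 7)\<^sup>2 + 15" by (simp add: add_nonneg_pos)
    finally show ?thesis by simp
  qed
  then have r0: "0 < r" using r1 by linarith
  have "K < 7"
  proof (rule ccontr)
    assume "\<not> K < 7"
    then have "E * (7 - K) \<le> 0" using b by (intro mult_nonneg_nonpos) auto
    moreover have "0 < (Q + 3) * r" using r0 b by (intro mult_pos_pos) auto
    ultimately show False using r by linarith
  qed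
  have "r < 7 - K"
  proof (rule ccontr)
    assume "\<not> r < 7 - K"
    then have "(Q + 3) * (7 - K) \<le> (Q + 3) * r" using b by (intro mult_left_mono) auto
    moreover have "E * (7 - K) < (Q + 3) * (7 - K)" using b \<open>K < 7\<close> by (intro mult_strict_right_mono) auto
    ultimately show False using r by linarith
  qed
  moreover have "K \<in> {0, 1, 2, 3, 4, 5, 6}" using b(4) \<open>K < 7\<close> by auto
  moreover have "r \<in> {1, 2, 3, 4, 5, 6}" using r0 \<open>r < 7 - K\<close> b(4) by auto
  ultimately show False using r r1 r2 b by auto
qed

text \<open>The left side equals d q + 1 - (j - 1) (d - j). The product (j - 1) (d - j) is concave
  in j, so on the given range it is smallest at the ends \<open>j = 3\<close> and
  \<open>j = d - 2\<close>, where it is 2 (d - 3).\<close>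

lemma pencil_arithmetic:
  fixes j d q :: nat
  assumes "3 \<le> j" "j + 2 \<le> d" "d \<le> q"
  shows "1 + j * q + (q + 1 - j) * (d - j) \<le> d * q + 1 - 2 * (d - 3)"
proof -
  obtain a where a: "j = 3 + a" using assms(1) le_Suc_ex by blast
  obtain b where b: "d = 3 + a + 2 + b" using assms(2) le_Suc_ex a by blast
  obtain t where t: "q = 3 + a + 2 + b + t" using assms(3) le_Suc_ex b by blast
  show ?thesis unfolding a b t by (simp add: algebra_simps)
qed

text \<open>The claim amounts to d^2 - 7 d + 14 \<ge> 0, whose discriminant is negative.\<close>

lemma general_position_arithmetic:
  fixes u d q :: nat
  assumes "2 * u + d * (d - 1) \<le> 2 * d * (q + 1)" "5 \<le> d" "d \<le> q"
  shows "u \<le> d * q + 1 - 2 * (d - 3)"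
proof -
  obtain r where r: "d = r + 5" using assms(2) by (metis add.commute le_Suc_ex)
  obtain t where t: "q = r + 5 + t" using assms(3) le_Suc_ex r by blast
  show ?thesis using assms(1) unfolding r t by (simp add: algebra_simps)
qed

lemma curve_bound:
  fixes g :: "'a::{finite,field} poly poly" and cs :: "'a vec3 list"
  defines "q \<equiv> card (UNIV :: 'a set)"
  assumes cs: "set cs \<subseteq> pts" and d: "length cs + e = d" "5 \<le> d" "d \<le> q"
    and g: "g \<in> form e" "lineless e g"
    and lt: "card (cover (set cs) \<union> zs e g) < d * q - d + 3"
  shows "card (cover (set cs) \<union> zs e g) \<le> d * q + 1 - 2 * (d - 3) \<or>
    card (cover (set cs) \<union> zs e g) \<le> (d - 1) * q + 2"
proof -
  let ?C = "set cs" and ?S = "zs e g"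
  let ?T = "cover ?C \<union> ?S"
  let ?k = "card ?C"
  have Sle: "card (line c \<inter> ?S) \<le> e" if "c \<in> pts" for c using lineless_line_bound[OF g(2) that] .
  have Te: "card ?T \<le> card (cover ?C) + card ?S" by (rule card_Un_le)
  have Cle: "card (cover ?C) \<le> ?k * q + 1" unfolding q_def by (rule card_cover_le[OF cs])
  have klen: "?k \<le> length cs" by (rule card_length)
  have S0: "card ?S = 0" if "e = 0"
  proof -
    have "?S = {}"
    proof (rule ccontr)
      assume "?S \<noteq> {}"
      then obtain P where P: "P \<in> ?S" by blast
      then have "{c \<in> pts. P \<in> line c} \<noteq> {}"
        using card_lines_through[of P] zs_sub by (intro notI) auto
      then obtain c where c: "c \<in> pts" "P \<in> line c" by blast
      then have "line c \<inter> ?S = {}" using Sle[OF c(1)] that by simp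
      then show False using c P by blast
    qed
    then show ?thesis by simp
  qed
  have Small: "card ?S \<le> (e - 1) * (q + 1) + 1" if "e \<noteq> 0"
    using lineless_bound[of "e - 1" g] g(2) that unfolding q_def by simp
  show ?thesis
  proof (cases "?k = length cs")
    case False
    \<comment> \<open>A repeated line adds to the degree but not to the points, so about q points
      are saved.\<close>
    then have k: "?k + 1 \<le> length cs" using klen by simp
    have "card ?T \<le> (d - 1) * q + 2"
    proof (cases "e = 0")
      case True
      have "?k * q \<le> (d - 1) * q" using k d(1) True by (intro mult_le_mono1) simp
      then show ?thesis using Te Cle S0[OF True] by linarith
    next
      case False
      obtain m where m: "e = Suc m" using False by (cases e) auto
      have "card ?T \<le> ?k * q + 1 + (m * (q + 1) + 1)" using Te Cle Small False m by simp
      also have "\<dots> \<le> ?k * q + 1 + (m * q + q + 1)" using d m by simp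
      also have "\<dots> = (?k + m + 1) * q + 2" by (simp add: algebra_simps)
      also have "\<dots> \<le> (d - 1) * q + 2" using k d(1) m by (intro add_right_mono mult_le_mono1) simp
      finally show ?thesis .
    qed
    then show ?thesis ..
  next
    case len: True
    then have dk: "d = e + ?k" using d by simp
    show ?thesis
    proof (cases "\<exists>P\<in>pts. 3 \<le> card {c \<in> ?C. P \<in> line c}")
      case True
      then obtain P where P: "P \<in> pts" "3 \<le> card {c \<in> ?C. P \<in> line c}" by blast
      let ?K = "{c \<in> ?C. P \<in> line c}"
      let ?j = "card ?K"
      have jk: "?j \<le> ?k" by (rule card_mono) auto
      have dq: "d \<le> d * q" using d by simp
      have K: "?K \<subseteq> pts" "?K \<noteq> {}"
      proof -
        show "?K \<subseteq> pts" using cs by blast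
        show "?K \<noteq> {}" using P(2) by (metis card.empty not_numeral_le_zero)
      qed
      have cK: "card (cover ?K) = ?j * q + 1"
        unfolding q_def by (rule pencil_card[where O' = P, OF K]) simp
      show ?thesis
      proof (cases "?j + 2 \<le> d")
        case True
        have "card ?T \<le> 1 + ?j * q + (q + 1 - ?j) * (?k - ?j + e)"
          unfolding q_def by (rule pencil_bound[OF P(1) cs zs_sub Sle])
        also have "?k - ?j + e = d - ?j" using dk jk by simp
        also have "1 + ?j * q + (q + 1 - ?j) * (d - ?j) \<le> d * q + 1 - 2 * (d - 3)"
          by (rule pencil_arithmetic[OF P(2) True d(3)])
        finally show ?thesis ..
      next
        case False
        \<comment> \<open>\<open>d\<close> concurrent lines have d q + 1 points, and
          \<open>d - 1\<close> of them with another line at least d q - d + 3; both are excluded by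
          \<open>lt\<close>. What remains is \<open>d - 1\<close> lines and a residual form of
          degree 1.\<close>
        then have j: "?j = d \<or> ?j + 1 = d" using jk dk by linarith
        show ?thesis
        proof (cases "?j = d")
          case True
          have "cover ?K \<subseteq> ?T" by blast
          then have "card (cover ?K) \<le> card ?T" by (rule card_mono[rotated]) simp
          moreover have "card (cover ?K) = d * q + 1" using cK by (simp only: True)
          ultimately have "d * q + 1 < d * q - d + 3" using lt by linarith
          then show ?thesis using d(2) dq by linarith
        next
          case False
          then have jd: "?j + 1 = d" using j by simp
          show ?thesis
          proof (cases "e = 0")
            case True
            then have "?C - ?K \<noteq> {}"
              using jd dk card_Diff_subset[of ?K ?C] by (intro notI) simp
            then obtain c where c: "c \<in> ?C" "c \<notin> ?K" by blast
            have cp: "c \<in> pts" using c cs by blast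
            have "line c \<inter> cover ?K = (\<Union>x\<in>?K. line c \<inter> line x)" by blast
            also have "card \<dots> \<le> (\<Sum>x\<in>?K. card (line c \<inter> line x))" by (rule card_UN_le) simp
            also have "\<dots> \<le> (\<Sum>x\<in>?K. 1)"
            proof (rule sum_mono)
              fix x assume x: "x \<in> ?K"
              then have "c \<noteq> x" "x \<in> pts" using c K by auto
              then obtain R where "line c \<inter> line x = {R}" using meet_card[OF cp] by metis
              then show "card (line c \<inter> line x) \<le> 1" by simp
            qed
            finally have "card (line c \<inter> cover ?K) \<le> ?j" by simp
            moreover have "card (line c \<union> cover ?K) + card (line c \<inter> cover ?K) = card (line c) + card (cover ?K)"
              using card_Un_Int[of "line c" "cover ?K"] by simp
            moreover have "line c \<union> cover ?K \<subseteq> ?T" using c by blast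
            then have "card (line c \<union> cover ?K) \<le> card ?T" by (rule card_mono[rotated]) simp
            moreover have "card (line c) = q + 1" unfolding q_def by (rule card_line[OF cp])
            moreover have "d * q = ?j * q + q" by (simp flip: jd)
            ultimately have "d * q + 2 \<le> card ?T + ?j" using cK by linarith
            then show ?thesis using lt jd dq by linarith
          next
            case False
            have e1: "e = 1" "?k = ?j" using False jd dk jk by linarith+
            have "card ?S \<le> 1" using Small e1(1) by simp
            moreover have "card (cover ?C) \<le> ?j * q + 1" using Cle by (simp only: e1(2))
            ultimately have "card ?T \<le> ?j * q + 2" using Te by linarith
            moreover have "?j = d - 1" using jd by linarith
            ultimately show ?thesis by simp
          qed
        qed
      qed
    next
      case False
      then have gp: "card {c \<in> ?C. P \<in> line c} \<le> 2" if "P \<in> pts" for P using that by force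
      have u: "2 * card (cover ?C) + ?k * (?k - 1) \<le> 2 * ?k * (q + 1)"
        unfolding q_def by (rule general_position_card[OF cs gp])
      consider "e = 0" | "e = 1" | "2 \<le> e" by linarith
      then show ?thesis
      proof cases
        case 1
        then have "?k = d" using dk by simp
        then have "card (cover ?C) \<le> d * q + 1 - 2 * (d - 3)"
          using general_position_arithmetic[OF _ d(2,3)] u by metis
        then show ?thesis using Te S0[OF 1] by linarith
      next
        case 2
        then have "card ?T \<le> ?k * q + 2" using Te Cle Small by simp
        then show ?thesis using dk 2 by simp
      next
        case 3
        have eq: "e \<le> q" "3 \<le> q" using d dk by auto
        show ?thesis
        proof (rule lineless_cases[OF g 3 eq[unfolded q_def], folded q_def])
          assume small: "card ?S \<le> (e - 1) * q + 1"
          obtain m where m: "e = Suc m" using 3 by (cases e) auto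
          have "card ?T \<le> (?k * q + 1) + (m * q + 1)" using Te Cle small m by simp
          also have "\<dots> = (d - 1) * q + 2" by (simp add: dk m algebra_simps)
          finally show ?thesis ..
        next
          assume full: "e = q" "card ?S \<le> (q - 1) * q + 2"
          then have k0: "?k = 0" "d = q" using dk d(3) by auto
          then have "cover ?C = {}" by simp
          then show ?thesis using full by (simp add: k0(2))
        next
          assume flex: "\<And>M. M \<subseteq> pts \<Longrightarrow> (\<And>c. c \<in> M \<Longrightarrow> line c \<inter> ?S = {}) \<Longrightarrow>
            (q + 3) * card ?S \<le> e * (q\<^sup>2 + q + 1 - card M)"
          show ?thesis
          proof (cases "\<exists>c\<in>?C. line c \<inter> ?S \<noteq> {}")
            case True
            \<comment> \<open>\<open>line c \<union> S\<close> has at most e q + 1 points and each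
              of the remaining lines adds at most q, in total (d - 1) q + 1.\<close>
            then obtain c P where c: "c \<in> ?C" "P \<in> line c \<inter> ?S" by blast
            have cp: "c \<in> pts" using c cs by blast
            have "card ?S \<le> card (line c \<inter> ?S) + q * (e - 1)"
              unfolding q_def by (rule arc_bound[OF zs_sub Sle cp c(2)])
            moreover have "card (line c \<union> ?S) + card (line c \<inter> ?S) = card (line c) + card ?S"
              using card_Un_Int[of "line c" ?S] by simp
            moreover have "card (line c) = q + 1" unfolding q_def by (rule card_line[OF cp])
            ultimately have 1: "card (line c \<union> ?S) \<le> q + 1 + q * (e - 1)" by linarith
            have "?T \<subseteq> (cover ?C - line c) \<union> (line c \<union> ?S)" by blast
            then have "card ?T \<le> card ((cover ?C - line c) \<union> (line c \<union> ?S))"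
              by (rule card_mono[rotated]) simp
            also have "\<dots> \<le> card (cover ?C - line c) + card (line c \<union> ?S)" by (rule card_Un_le)
            also have "card (cover ?C - line c) \<le> card (?C - {c}) * q"
              unfolding q_def by (rule card_cover_minus_line[OF cs cp])
            finally have 2: "card ?T \<le> card (?C - {c}) * q + (q + 1 + q * (e - 1))" using 1 by linarith
            obtain m where m: "e = Suc m" using 3 by (cases e) auto
            have "Suc (card (?C - {c})) = ?k" by (rule card_Suc_Diff1) (use c in auto)
            then have "d - 1 = Suc (card (?C - {c})) + m" using dk m by simp
            then have "card ?T \<le> (d - 1) * q + 2" using 2 m by (simp add: algebra_simps)
            then show ?thesis ..
          next
            case False
            \<comment> \<open>No line of the arrangement meets the residual curve, so the
              arrangement itself is the set of missed lines.\<close>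
            then have "(q + 3) * card ?S \<le> e * (q\<^sup>2 + q + 1 - ?k)"
              by (intro flex cs) blast
            then have "card ?S + card (cover ?C) \<le> (e + ?k) * q + 1 - 2 * (e + ?k - 3) \<or>
               card ?S + card (cover ?C) \<le> (e + ?k - 1) * q + 2"
              using u 3 d dk by (intro flex_arithmetic) auto
            then show ?thesis using Te unfolding dk by linarith
          qed
        qed
      qed
    qed
  qed
qed

section \<open>Curves in the projective plane\<close>

definition dehom :: "nat \<Rightarrow> (nat \<times> nat \<times> nat \<Rightarrow> 'a::field) \<Rightarrow> 'a poly poly" where
  "dehom d c = (\<Sum>(i, j)\<in>tri d. monom (monom (c (i, j, d - i - j)) i) j)"

definition hom_coeffs :: "nat \<Rightarrow> 'a::field poly poly \<Rightarrow> nat \<times> nat \<times> nat \<Rightarrow> 'a" where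
  "hom_coeffs d f = (\<lambda>(i, j, k). if i + j + k = d then cf f i j else 0)"

lemma cf_dehom: "cf (dehom d c) i j = (if i + j \<le> d then c (i, j, d - i - j) else 0)"
proof -
  have "cf (dehom d c) i j = (\<Sum>p\<in>tri d. if p = (i, j) then c (i, j, d - i - j) else 0)"
    unfolding dehom_def coeff_sum by (intro sum.cong) (auto split: if_splits)
  then show ?thesis by (simp add: mem_tri)
qed

lemma form_dehom: "dehom d c \<in> form d"
  by (simp add: form_def cf_dehom)

lemma dehom_hom_coeffs: "f \<in> form d \<Longrightarrow> dehom d (hom_coeffs d f) = f"
  by (intro poly_eqI) (auto simp: cf_dehom hom_coeffs_def formD)

lemma ev_dehom: "ev d (dehom d c) v = eval_poly3 d c v"
proof -
  obtain x y z where v: "v = (x, y, z)" by (metis prod.exhaust)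
  have "eval_poly3 d c v = (\<Sum>(i, j, k)\<in>monos3 d. c (i, j, k) * x ^ i * y ^ j * z ^ k)"
    by (simp add: eval_poly3_def v)
  also have "\<dots> = (\<Sum>(i, j)\<in>tri d. c (i, j, d - i - j) * x ^ i * y ^ j * z ^ (d - i - j))"
    by (rule sum.reindex_bij_witness[of _ "\<lambda>(i, j). (i, j, d - i - j)" "\<lambda>(i, j, k). (i, j)"])
       (auto simp: monos3_def tri_def)
  also have "\<dots> = ev d (dehom d c) v"
    unfolding v ev_def' by (intro sum.cong) (auto simp: mem_tri cf_dehom mult.assoc)
  finally show ?thesis ..
qed

lemma dehom_nonzero:
  assumes "hom_poly3 d c"
  shows "dehom d c \<noteq> 0"
proof
  assume 0: "dehom d c = 0"
  have "c (i, j, k) = 0" for i j k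
  proof (cases "i + j + k = d")
    case True
    then have "c (i, j, k) = cf (dehom d c) i j" by (auto simp: cf_dehom)
    then show ?thesis by (simp add: 0)
  next
    case False
    then show ?thesis using assms by (simp add: hom_poly3_def)
  qed
  then show False using assms by (simp add: hom_poly3_def)
qed

lemma hom_poly3_hom_coeffs:
  assumes "f \<in> form d" "f \<noteq> 0"
  shows "hom_poly3 d (hom_coeffs d f)"
proof -
  have "\<exists>i j. cf f i j \<noteq> 0"
  proof (rule ccontr)
    assume "\<not> ?thesis"
    then have "f = 0" by (intro poly_eqI) simp
    with assms show False by simp
  qed
  then obtain i j where ij: "cf f i j \<noteq> 0" by blast
  then have "i + j \<le> d" using formD[OF assms(1)] by (metis not_le)
  then have "hom_coeffs d f (i, j, d - i - j) \<noteq> 0" using ij by (simp add: hom_coeffs_def)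
  then show ?thesis unfolding hom_poly3_def
    by (intro conjI exI[of _ i] exI[of _ j] exI[of _ "d - i - j"]) (simp_all add: hom_coeffs_def)
qed

lemma proj_class_eq: "proj_class v = {scale l v | l. l \<noteq> 0}"
  by (cases v) (simp add: proj_class_def)

text \<open>Every projective point has a normalized representative, and the vanishing of a form does
  not depend on the representative, so the count can be made in \<open>zs\<close>.\<close>

lemma curve_points_eq: "curve_points d c = proj_class ` zs d (dehom d c)"
proof (intro equalityI subsetI)
  fix P assume "P \<in> curve_points d c"
  then obtain v where v: "v \<noteq> (0, 0, 0)" "P = proj_class v" "\<forall>x\<in>P. eval_poly3 d c x = 0"
    by (auto simp: curve_points_def proj_plane_def)
  then obtain s p where p: "s \<noteq> 0" "p \<in> pts" "v = scale s p" by (meson normalize)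
  have "P = proj_class p"
  proof (intro equalityI subsetI)
    fix x assume "x \<in> P"
    then obtain l where "l \<noteq> 0" "x = scale l (scale s p)" using v(2) p by (auto simp: proj_class_eq)
    then have "x = scale (l * s) p" "l * s \<noteq> 0" using p(1) by (cases p; simp add: mult.assoc)+
    then show "x \<in> proj_class p" unfolding proj_class_eq by blast
  next
    fix x assume "x \<in> proj_class p"
    then obtain l where "l \<noteq> 0" "x = scale l p" by (auto simp: proj_class_eq)
    then have "x = scale (l / s) v" "l / s \<noteq> 0" using p by (cases p; simp)+
    then show "x \<in> P" unfolding v(2) proj_class_eq by blast
  qed
  moreover have "p = scale 1 p" by (cases p) simp
  then have "p \<in> proj_class p" unfolding proj_class_eq by (metis (mono_tags, lifting) mem_Collect_eq one_neq_zero)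
  ultimately have "ev d (dehom d c) p = 0" using v(3) by (simp add: ev_dehom)
  then show "P \<in> proj_class ` zs d (dehom d c)" using p(2) \<open>P = proj_class p\<close> by (auto simp: zs_def)
next
  fix P assume "P \<in> proj_class ` zs d (dehom d c)"
  then obtain p where p: "p \<in> pts" "ev d (dehom d c) p = 0" "P = proj_class p" unfolding zs_def by blast
  have "eval_poly3 d c x = 0" if x: "x \<in> P" for x
  proof -
    obtain l where l: "x = scale l p" using x p(3) by (auto simp: proj_class_eq)
    have "ev d (dehom d c) (scale l p) = l ^ d * ev d (dehom d c) p"
      using ev_scale[of d "dehom d c" l] by (cases p) (simp only: scale.simps)
    then show ?thesis using p(2) by (simp add: l flip: ev_dehom)
  qed
  moreover have "P \<in> proj_plane" unfolding proj_plane_def p(3) using pts_nonzero[OF p(1)] by blast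
  ultimately show "P \<in> curve_points d c" by (simp add: curve_points_def)
qed

lemma proj_class_inj: "inj_on proj_class pts"
proof (rule inj_onI)
  fix p r :: "'a vec3" assume *: "p \<in> pts" "r \<in> pts" "proj_class p = proj_class r"
  have "p = scale 1 p" by (cases p) simp
  then have "p \<in> proj_class p" unfolding proj_class_eq by (metis (mono_tags, lifting) mem_Collect_eq one_neq_zero)
  then have "p \<in> proj_class r" by (simp only: *(3))
  then obtain l where "p = scale l r" unfolding proj_class_eq by blast
  then show "p = r" by (rule scale_pts_unique(1)[OF *(1,2)])
qed

lemma card_curve_points: "card (curve_points d c) = card (zs d (dehom d c))"
  unfolding curve_points_eq by (intro card_image inj_on_subset[OF proj_class_inj] zs_sub)

text \<open>The extremal curve: \<open>d - 2\<close> lines \<open>x = a z\<close> through \<open>(0 : 1 : 0)\<close>, one of them being \<open>x = 0\<close>,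
  and the two lines \<open>y = 0\<close> and \<open>y = x\<close>, which meet on \<open>x = 0\<close>.\<close>

lemma pencil_form:
  fixes A :: "'a::{finite,field} set"
  shows "\<exists>f\<in>form (card A). f \<noteq> 0 \<and> zs (card A) f = (\<Union>a\<in>A. line (1, 0, - a))"
  using finite[of A]
proof (induction A rule: finite_induct)
  case empty
  have "ev 0 1 P = 1" for P :: "'a vec3" by (cases P) (simp add: hev_def tri_def)
  then have "zs 0 (1 :: 'a poly poly) = {}" by (simp add: zs_def)
  then show ?case by (intro bexI[of _ 1]) (simp_all add: form_1)
next
  case (insert a A)
  then obtain f where f: "f \<in> form (card A)" "f \<noteq> 0" "zs (card A) f = (\<Union>a\<in>A. line (1, 0, - a))" by blast
  let ?g = "lform (1, 0, - a) * f"
  have c: "card (insert a A) = 1 + card A" using insert.hyps by simp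
  show ?case unfolding c
  proof (intro bexI[of _ ?g] conjI)
    show "?g \<in> form (1 + card A)" by (rule form_mult[OF form_lform f(1)])
    show "?g \<noteq> 0" using f(2) by simp
    show "zs (1 + card A) ?g = (\<Union>a\<in>insert a A. line (1, 0, - a))"
      unfolding zs_mult[OF form_lform f(1)] by (simp add: f(3) zs_lform del: lform.simps)
  qed
qed

lemma extremal_curve:
  fixes d :: nat
  defines "q \<equiv> card (UNIV :: 'a::{finite,field} set)"
  assumes d: "5 \<le> d" "d \<le> q"
  obtains f :: "'a::{finite,field} poly poly" where "f \<in> form d" "f \<noteq> 0" "card (zs d f) = d * q + 1 - 2 * (d - 3)"
proof -
  \<comment> \<open>Besides 0, \<open>d - 3\<close> nonzero abscissas are needed; they exist because
    \<open>d \<le> q\<close>.\<close>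
  have "d - 3 \<le> card (UNIV - {0 :: 'a})" using d by (simp add: q_def card_Diff_singleton)
  then obtain B where B: "B \<subseteq> UNIV - {0 :: 'a}" "card B = d - 3"
    by (metis obtain_subset_with_card_n)
  define A where "A = insert 0 B"
  have A: "0 \<in> A" "card A = d - 2" using B d by (auto simp: A_def card_insert_if)
  obtain g where g: "g \<in> form (card A)" "g \<noteq> 0" "zs (card A) g = (\<Union>a\<in>A. line (1, 0, - a))"
    using pencil_form[of A] by blast
  let ?l = "lform (0, 1, 0) :: 'a poly poly" and ?m = "lform (1, - 1, 0) :: 'a poly poly"
  define f where "f = ?l * (?m * g)"
  have dA: "d = 1 + (1 + card A)" using A d by simp
  have mg: "?m * g \<in> form (1 + card A)" by (rule form_mult[OF form_lform g(1)])
  have ff: "f \<in> form d" unfolding dA f_def by (rule form_mult[OF form_lform mg])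
  have "?l \<noteq> 0" "?m \<noteq> 0" by simp_all
  then have f0: "f \<noteq> 0" using g(2) unfolding f_def by (metis mult_eq_0_iff)
  have zf: "zs d f = line (0, 1, 0) \<union> (line (1, - 1, 0) \<union> (\<Union>a\<in>A. line (1, 0, - a)))"
    unfolding dA f_def zs_mult[OF form_lform mg] zs_mult[OF form_lform g(1)] g(3)
    by (simp add: zs_lform del: lform.simps)
  \<comment> \<open>\<open>?P\<close> holds the affine points of the \<open>d - 2\<close> vertical
    lines, \<open>?Q\<close> and \<open>?R\<close> those of y = 0 and y = x off these lines,
    disjoint because \<open>0 \<in> A\<close>, and \<open>?I\<close> the three points at
    infinity.\<close>
  let ?P = "(\<lambda>(x, y). (x, y, 1)) ` (A \<times> UNIV) :: 'a vec3 set"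
  let ?Q = "(\<lambda>x. (x, 0, 1)) ` (- A) :: 'a vec3 set"
  let ?R = "(\<lambda>x. (x, x, 1)) ` (- A) :: 'a vec3 set"
  let ?I = "{(1, 0, 0), (1, 1, 0), (0, 1, 0)} :: 'a vec3 set"
  have disj: "T \<inter> U = {}" if "T \<subseteq> W" "U \<subseteq> - W" for T U W :: "'a vec3 set"
    using that by blast
  have mem: "(x, y, 1) \<in> zs d f \<longleftrightarrow> y = 0 \<or> x = y \<or> x \<in> A"
    "(x, 1, 0) \<in> zs d f \<longleftrightarrow> x = 1 \<or> x = 0" "(1, 0, 0) \<in> zs d f" for x y
    using A(1) unfolding zf line_def by auto
  have "zs d f = ?I \<union> (?P \<union> (?Q \<union> ?R))"
  proof (rule equalityI)
    show "zs d f \<subseteq> ?I \<union> (?P \<union> (?Q \<union> ?R))"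
    proof
      fix v assume v: "v \<in> zs d f"
      then have "v \<in> pts" using zs_sub by blast
      then show "v \<in> ?I \<union> (?P \<union> (?Q \<union> ?R))"
      proof (cases rule: pts_cases)
        case (affine x y)
        then have "y = 0 \<or> x = y \<or> x \<in> A" using v mem(1)[of x y] by simp
        then consider "x \<in> A" | "x \<notin> A" "y = 0" | "x \<notin> A" "y = x" by metis
        then show ?thesis
        proof cases
          case 1
          then have "v \<in> ?P" by (intro image_eqI[of _ _ "(x, y)"]) (simp_all add: affine)
          then show ?thesis by blast
        qed (simp_all add: affine)
      next
        case (infinite x)
        then show ?thesis using v mem(2)[of x] by auto
      qed simp
    qed
    have "?I \<subseteq> zs d f" using mem(2)[of 0] mem(2)[of 1] mem(3) by simp
    moreover have "?P \<subseteq> zs d f" "?Q \<subseteq> zs d f" "?R \<subseteq> zs d f" using mem(1) by auto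
    ultimately show "?I \<union> (?P \<union> (?Q \<union> ?R)) \<subseteq> zs d f" by (simp only: Un_subset_iff)
  qed
  moreover have "card ?P = (d - 2) * q"
    by (subst card_image) (auto simp: inj_on_def A q_def card_cartesian_product)
  moreover have cQ: "card ?Q = q - (d - 2)"
    by (subst card_image) (auto simp: inj_on_def A q_def card_Diff_subset Compl_eq_Diff_UNIV)
  moreover have "card ?R = q - (d - 2)"
    by (subst card_image) (auto simp: inj_on_def A q_def card_Diff_subset Compl_eq_Diff_UNIV)
  moreover have "card (?Q \<union> ?R) = card ?Q + card ?R"
    by (rule card_Un_disjoint) (use A(1) in auto)
  moreover have "card (?P \<union> (?Q \<union> ?R)) = card ?P + card (?Q \<union> ?R)"
  proof (rule card_Un_disjoint)
    show "?P \<inter> (?Q \<union> ?R) = {}" by (rule disj[of _ "{v. fst v \<in> A}"]) auto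
  qed simp_all
  moreover have "card (?I \<union> (?P \<union> (?Q \<union> ?R))) = card ?I + card (?P \<union> (?Q \<union> ?R))"
  proof (rule card_Un_disjoint)
    show "?I \<inter> (?P \<union> (?Q \<union> ?R)) = {}"
      by (rule disj[of _ "{v. snd (snd v) = 0}"]) auto
  qed simp_all
  moreover have "card ?I = 3" by simp
  ultimately have card: "card (zs d f) = 3 + ((d - 2) * q + ((q - (d - 2)) + (q - (d - 2))))" by simp
  obtain r where r: "d = r + 5" using d(1) by (metis add.commute le_Suc_ex)
  obtain t where t: "q = r + 5 + t" using d(2) le_Suc_ex r by blast
  have "card (zs d f) = d * q + 1 - 2 * (d - 3)" unfolding card unfolding r t by (simp add: algebra_simps)
  with ff f0 show ?thesis by (rule that)
qed

theorem theorem4p4: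
  fixes q d :: nat
  assumes "q = card (UNIV :: 'a::{finite,field} set)"
    and "5 \<le> d" and "d \<le> q"
  shows "(2 * d \<le> q + 5 \<longrightarrow> N3 TYPE('a) d = d * q + 1 - 2 * (d - 3))
       \<and> (q + 6 \<le> 2 * d \<longrightarrow> N3 TYPE('a) d \<le> (d - 1) * q + 2)"
proof -
  let ?V = "d * q + 1 - 2 * (d - 3)"
  define X where "X = {card (curve_points d c) | c :: nat \<times> nat \<times> nat \<Rightarrow> 'a.
      hom_poly3 d c \<and> card (curve_points d c) < d * q - d + 3}"
  have N3: "N3 TYPE('a) d = Max X" by (simp add: N3_def X_def assms(1))
  have fin: "finite X" by (rule finite_subset[of _ "{..< d * q - d + 3}"]) (auto simp: X_def)
  obtain r where r: "d = r + 5" using assms(2) by (metis add.commute le_Suc_ex)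
  obtain t where t: "q = r + 5 + t" using assms(3) le_Suc_ex r by blast
  \<comment> \<open>Besides attainment, this makes \<open>X\<close> nonempty, so that
    \<open>Max\<close> is meaningful in both regimes.\<close>
  have V: "?V \<in> X"
  proof -
    obtain f :: "'a poly poly" where f: "f \<in> form d" "f \<noteq> 0" "card (zs d f) = ?V"
      using extremal_curve[OF assms(2), where ?'a = 'a] assms by blast
    have "card (curve_points d (hom_coeffs d f)) = ?V"
      by (simp only: card_curve_points dehom_hom_coeffs[OF f(1)] f(3))
    \<comment> \<open>This inequality amounts to \<open>4 < d\<close>.\<close>
    moreover have "?V < d * q - d + 3" unfolding t unfolding r by (simp add: algebra_simps)
    ultimately show ?thesis unfolding X_def
      using hom_poly3_hom_coeffs[OF f(1,2)] by (intro CollectI exI[of _ "hom_coeffs d f"]) simp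
  qed
  have le: "x \<le> ?V \<or> x \<le> (d - 1) * q + 2" if "x \<in> X" for x
  proof -
    from that obtain c :: "nat \<times> nat \<times> nat \<Rightarrow> 'a" where c: "hom_poly3 d c"
      "x = card (zs d (dehom d c))" "x < d * q - d + 3"
      by (auto simp: X_def card_curve_points)
    obtain cs g e where s: "set cs \<subseteq> pts" "length cs + e = d" "g \<in> form e" "lineless e g"
      "zs d (dehom d c) = cover (set cs) \<union> zs e g"
      using split_off_lines[OF form_dehom dehom_nonzero[OF c(1)]] assms(1,3) by metis
    show ?thesis
      using curve_bound[OF s(1,2) assms(2) _ s(3,4)] c(2,3) assms(1,3) unfolding s(5) by simp
  qed
  show ?thesis
  proof (intro conjI impI)
    assume *: "2 * d \<le> q + 5"
    \<comment> \<open>The two bounds coincide for \<open>2 * d = q + 5\<close>.\<close>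
    have "(d - 1) * q + 2 \<le> ?V" using * unfolding t unfolding r by (simp add: algebra_simps)
    then show "N3 TYPE('a) d = ?V" unfolding N3 using le V fin by (intro Max_eqI) (meson order_trans)+
  next
    assume *: "q + 6 \<le> 2 * d"
    have "?V \<le> (d - 1) * q + 2" using * unfolding t unfolding r by (simp add: algebra_simps)
    then have "x \<le> (d - 1) * q + 2" if "x \<in> X" for x using le[OF that] by linarith
    then show "N3 TYPE('a) d \<le> (d - 1) * q + 2" unfolding N3 using fin V by (intro Max.boundedI) auto
  qed
qed

end
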